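(* Let $F_1,\ldots,F_m$ be polynomials in $\mathbb{C}[z_1,\ldots,z_n]$, and let $\mathcal{P}\subseteq\mathbb{R}^n_{\ge 0}$ be a smooth lattice polytope that contains the origin, the supports $\operatorname{supp}F_j$ ($1\le j\le m$), and the supports of the coordinate functions $z_1,\ldots,z_n$ (i.e. the unit vectors $e_1,\ldots,e_n$). Assume that the $F_j$ have no common zeros at infinity (with respect to $\mathcal{P}$). Then there is a number $\nu_F$ such that the following holds: for every real number $e\ge 0$ for which $e\mathcal{P}$ is a lattice polytope, and every polynomial $\Phi\in (F)$ with $\operatorname{supp}\Phi\subseteq e\mathcal{P}$, there are polynomials $G_1,\ldots,G_m\in\mathbb{C}[z_1,\ldots,z_n]$ such that $$\sum_{j=1}^m F_jG_j=\Phi$$ and $$\operatorname{supp}(F_jG_j)\subseteq \max(\nu_F,e)\,\mathcal{P}\qquad (1\le j\le m).$$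
   Context: Notation. $(F)$ is the ideal of $\mathbb{C}[z_1,\ldots,z_n]$ generated by $F_1,\ldots,F_m$. For a polynomial $F=\sum_{\alpha}c_\alpha z^\alpha$, $\operatorname{supp}F=\{\alpha\in\mathbb{Z}^n: c_\alpha\neq 0\}$. For $c\ge 0$, $c\mathcal{P}=\{cx:x\in\mathcal{P}\}$. Lattice polytopes. A lattice polytope in $\mathbb{R}^n$ is the convex hull of finitely many points of $\mathbb{Z}^n$. An $n$-dimensional lattice polytope $\mathcal{P}$ is smooth (or Delzant) if for each vertex $v$ of $\mathcal{P}$ the smallest integer normal directions of the facets of $\mathcal{P}$ containing $v$ form a basis of $\mathbb{Z}^n$. Compatible fans. Let $\mathcal{P}$ be a lattice polytope. A complete fan $\Delta$ in $\mathbb{R}^n$ (of rational, strongly convex polyhedral cones) is compatible with $\mathcal{P}$ if it refines the (inner) normal fan of $\mathcal{P}$, i.e. if for every cone $\sigma\in\Delta$ there is a vertex $v_\sigma$ of $\mathcal{P}$ such that $\langle u,v_\sigma\rangle=\min_{x\in\mathcal{P}}\langle u,x\rangle$ for all $u\in\sigma$. Let $X_\Delta$ be the toric variety of $\Delta$, obtained by gluing the affine charts $\mathcal{U}_\sigma=\operatorname{Spec}\mathbb{C}[\sigma^\vee\cap\mathbb{Z}^n]$, $\sigma\in\Delta$, where $\sigma^\vee=\{x\in\mathbb{R}^n:\langle u,x\rangle\ge 0 \text{ for all } u\in\sigma\}$. Then $\mathcal{P}$ defines a line bundle $\mathcal{O}(D_{\mathcal{P}})$ on $X_\Delta$ whose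 global sections correspond to the (Laurent) polynomials $F$ with $\operatorname{supp}F\subseteq\mathcal{P}$; on the chart $\mathcal{U}_\sigma$ the section $f$ corresponding to $F$ is given, in a local trivialization, by the regular function $z^{-v_\sigma}F$. No common zeros at infinity. Let $\mathcal{P}\subseteq\mathbb{R}^n_{\ge0}$ be a lattice polytope containing the origin and $\operatorname{supp}F_1,\ldots,\operatorname{supp}F_m$. Then there is a complete fan $\Delta$ compatible with $\mathcal{P}$ that contains the first orthant $\sigma_0=\mathbb{R}^n_{\ge 0}$ as a cone. Identify $\mathcal{U}_{\sigma_0}$ with $\mathbb{C}^n$ and let $V_\infty=X_\Delta\setminus\mathcal{U}_{\sigma_0}$ (the variety at infinity). The $F_j$ have no common zeros at infinity (with respect to $\mathcal{P}$) if the sections $f_1,\ldots,f_m$ of $\mathcal{O}(D_{\mathcal{P}})$ over $X_\Delta$ corresponding to $F_1,\ldots,F_m$ have no common zero in $V_\infty$. This does not depend on the choice of such a $\Delta$. *)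

theory Defs
  imports "HOL-Analysis.Analysis" "HOL-Library.Poly_Mapping" "HOL-Library.FuncSet"
begin

text \<open>
  The finite index type \<^typ>\<open>'n\<close> plays the role of \<open>{1, ..., n}\<close>. Polynomials and Laurent polynomials
  are the monoid algebras over \<open>\<complex>\<close> of the exponent monoids \<open>\<nat>\<^sup>n\<close> and \<open>\<int>\<^sup>n\<close>, with the convolution
  product of \<^theory>\<open>HOL-Library.Poly_Mapping\<close>.
\<close>

type_synonym 'n cpoly = "(nat ^ 'n) \<Rightarrow>\<^sub>0 complex"
type_synonym 'n laurent = "(int ^ 'n) \<Rightarrow>\<^sub>0 complex"

definition int_exp :: "nat ^ 'n \<Rightarrow> int ^ 'n::finite" where
  "int_exp \<alpha> = (\<chi> i. int (\<alpha> $ i))"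

definition real_vec :: "int ^ 'n \<Rightarrow> real ^ 'n::finite" where
  "real_vec a = (\<chi> i. of_int (a $ i))"

definition laurent_of :: "'n::finite cpoly \<Rightarrow> 'n laurent" where
  "laurent_of F = (\<Sum>\<alpha>\<in>Poly_Mapping.keys F.
      Poly_Mapping.single (int_exp \<alpha>) (Poly_Mapping.lookup F \<alpha>))"

definition supp :: "'n::finite cpoly \<Rightarrow> (real ^ 'n) set" where
  "supp F = (\<lambda>\<alpha>. real_vec (int_exp \<alpha>)) ` Poly_Mapping.keys F"

text \<open>Ideals of a commutative ring are the submodules of the ring as a module over itself.\<close>

definition gen_ideal :: "'a::comm_ring_1 set \<Rightarrow> 'a set" where
  "gen_ideal S = module.span (*) S"

definition lattice_polytope :: "(real ^ 'n::finite) set \<Rightarrow> bool" where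
  "lattice_polytope P \<longleftrightarrow> (\<exists>S. finite S \<and> P = convex hull (real_vec ` S))"

definition primitive_inner_normal ::
    "(real ^ 'n::finite) set \<Rightarrow> (real ^ 'n) set \<Rightarrow> int ^ 'n \<Rightarrow> bool" where
  "primitive_inner_normal P Q u \<longleftrightarrow>
     Gcd (range (($) u)) = 1 \<and>
     (\<exists>c. (\<forall>x\<in>P. c \<le> real_vec u \<bullet> x) \<and> Q = {x \<in> P. real_vec u \<bullet> x = c})"

definition lattice_basis :: "(int ^ 'n::finite) set \<Rightarrow> bool" where
  "lattice_basis B \<longleftrightarrow>
     \<not> module.dependent (*s) B \<and> module.span (*s) B = UNIV"

definition smooth_polytope :: "(real ^ 'n::finite) set \<Rightarrow> bool" where
  "smooth_polytope P \<longleftrightarrow>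
     lattice_polytope P \<and> aff_dim P = int CARD('n) \<and>
     (\<forall>v. v extreme_point_of P \<longrightarrow>
        lattice_basis {u. \<exists>Q. Q facet_of P \<and> v \<in> Q \<and> primitive_inner_normal P Q u})"

definition rational_cone :: "(real ^ 'n::finite) set \<Rightarrow> bool" where
  "rational_cone \<sigma> \<longleftrightarrow> (\<exists>S. finite S \<and> \<sigma> = convex_cone hull (real_vec ` S))"

definition strongly_convex :: "(real ^ 'n::finite) set \<Rightarrow> bool" where
  "strongly_convex \<sigma> \<longleftrightarrow> \<sigma> \<inter> uminus ` \<sigma> = {0}"

text \<open>The empty set counts as a face for \<^term>\<open>(face_of)\<close>, but not as a face of a cone.\<close>

definition is_fan :: "(real ^ 'n::finite) set set \<Rightarrow> bool" where
  "is_fan \<Delta> \<longleftrightarrow> finite \<Delta> \<and>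
     (\<forall>\<sigma>\<in>\<Delta>. rational_cone \<sigma> \<and> strongly_convex \<sigma>) \<and>
     (\<forall>\<sigma>\<in>\<Delta>. \<forall>\<tau>. \<tau> face_of \<sigma> \<and> \<tau> \<noteq> {} \<longrightarrow> \<tau> \<in> \<Delta>) \<and>
     (\<forall>\<sigma>\<in>\<Delta>. \<forall>\<tau>\<in>\<Delta>. (\<sigma> \<inter> \<tau>) face_of \<sigma> \<and> (\<sigma> \<inter> \<tau>) face_of \<tau>)"

definition complete_fan :: "(real ^ 'n::finite) set set \<Rightarrow> bool" where
  "complete_fan \<Delta> \<longleftrightarrow> is_fan \<Delta> \<and> \<Union>\<Delta> = UNIV"

text \<open>Vertices of lattice polytopes are integral, so \<open>v\<^sub>\<sigma>\<close> can be taken as an integer vector.\<close>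

definition cone_vertex ::
    "(real ^ 'n::finite) set \<Rightarrow> (real ^ 'n) set \<Rightarrow> int ^ 'n \<Rightarrow> bool" where
  "cone_vertex P \<sigma> v \<longleftrightarrow> real_vec v extreme_point_of P \<and>
     (\<forall>u\<in>\<sigma>. \<forall>x\<in>P. u \<bullet> real_vec v \<le> u \<bullet> x)"

definition compatible_fan ::
    "(real ^ 'n::finite) set \<Rightarrow> (real ^ 'n) set set \<Rightarrow> bool" where
  "compatible_fan P \<Delta> \<longleftrightarrow> (\<forall>\<sigma>\<in>\<Delta>. \<exists>v. cone_vertex P \<sigma> v)"

definition first_orthant :: "(real ^ 'n::finite) set" where
  "first_orthant = {x. \<forall>i. 0 \<le> x $ i}"

definition dual_cone :: "(real ^ 'n::finite) set \<Rightarrow> (real ^ 'n) set" where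
  "dual_cone \<sigma> = {x. \<forall>u\<in>\<sigma>. 0 \<le> u \<bullet> x}"

definition coord_ring :: "(real ^ 'n::finite) set \<Rightarrow> 'n laurent set" where
  "coord_ring \<sigma> = {f. \<forall>a\<in>Poly_Mapping.keys f. real_vec a \<in> dual_cone \<sigma>}"

text \<open>
  The closed points of the affine variety \<open>U\<^sub>\<sigma> = Spec \<complex>[\<sigma>\<^sup>\<or> \<inter> \<int>\<^sup>n]\<close>, as \<open>\<complex>\<close>-algebra
  homomorphisms from \<^term>\<open>coord_ring \<sigma>\<close> to \<open>\<complex>\<close>.
  They are extensional so that equality of points is equality of homomorphisms.
\<close>

definition chart :: "(real ^ 'n::finite) set \<Rightarrow> ('n laurent \<Rightarrow> complex) set" where
  "chart \<sigma> = {\<phi> \<in> extensional (coord_ring \<sigma>).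
     (\<forall>c. \<phi> (Poly_Mapping.single 0 c) = c) \<and>
     (\<forall>f\<in>coord_ring \<sigma>. \<forall>g\<in>coord_ring \<sigma>. \<phi> (f + g) = \<phi> f + \<phi> g \<and> \<phi> (f * g) = \<phi> f * \<phi> g)}"

text \<open>
  The charts of \<open>\<sigma>\<close> and \<open>\<tau>\<close> are glued along the chart of \<open>\<sigma> \<inter> \<tau>\<close>, which embeds into both by restriction
  of homomorphisms. For a fan \<open>\<Delta>\<close> this is an equivalence relation on the disjoint union of the charts.
\<close>

definition glue :: "(real ^ 'n::finite) set set \<Rightarrow>
    (((real ^ 'n) set \<times> ('n laurent \<Rightarrow> complex)) \<times> ((real ^ 'n) set \<times> ('n laurent \<Rightarrow> complex))) set" where
  "glue \<Delta> = {((\<sigma>, restrict \<psi> (coord_ring \<sigma>)), (\<tau>, restrict \<psi> (coord_ring \<tau>))) | \<sigma> \<tau> \<psi>.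
     \<sigma> \<in> \<Delta> \<and> \<tau> \<in> \<Delta> \<and> \<psi> \<in> chart (\<sigma> \<inter> \<tau>)}"

definition toric_variety ::
    "(real ^ 'n::finite) set set \<Rightarrow> ((real ^ 'n) set \<times> ('n laurent \<Rightarrow> complex)) set set" where
  "toric_variety \<Delta> = (SIGMA \<sigma>:\<Delta>. chart \<sigma>) // glue \<Delta>"

definition chart_image :: "(real ^ 'n::finite) set set \<Rightarrow> (real ^ 'n) set \<Rightarrow>
    ((real ^ 'n) set \<times> ('n laurent \<Rightarrow> complex)) set set" where
  "chart_image \<Delta> \<sigma> = (\<lambda>\<phi>. glue \<Delta> `` {(\<sigma>, \<phi>)}) ` chart \<sigma>"

definition variety_at_infinity ::
    "(real ^ 'n::finite) set set \<Rightarrow> ((real ^ 'n) set \<times> ('n laurent \<Rightarrow> complex)) set set" where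
  "variety_at_infinity \<Delta> = toric_variety \<Delta> - chart_image \<Delta> first_orthant"

definition local_section :: "int ^ 'n \<Rightarrow> 'n::finite cpoly \<Rightarrow> 'n laurent" where
  "local_section v F = Poly_Mapping.single (- v) 1 * laurent_of F"

text \<open>
  The choice of the chart representing \<open>p\<close> and of the vertex is immaterial: two choices change
  the local expression \<open>z\<^bsup>-v\<^esup> F\<close> of the section by a unit.
\<close>

definition section_zero :: "(real ^ 'n::finite) set \<Rightarrow> 'n cpoly \<Rightarrow>
    ((real ^ 'n) set \<times> ('n laurent \<Rightarrow> complex)) set \<Rightarrow> bool" where
  "section_zero P F p \<longleftrightarrow>
     (\<exists>(\<sigma>, \<phi>)\<in>p. \<exists>v. cone_vertex P \<sigma> v \<and> \<phi> (local_section v F) = 0)"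

text \<open>The condition does not depend on the choice of the fan, so quantifying it existentially is harmless.\<close>

definition no_common_zeros_at_infinity ::
    "(real ^ 'n::finite) set \<Rightarrow> nat \<Rightarrow> (nat \<Rightarrow> 'n cpoly) \<Rightarrow> bool" where
  "no_common_zeros_at_infinity P m F \<longleftrightarrow>
     (\<exists>\<Delta>. complete_fan \<Delta> \<and> compatible_fan P \<Delta> \<and> first_orthant \<in> \<Delta> \<and>
        \<not> (\<exists>p\<in>variety_at_infinity \<Delta>. \<forall>j\<in>{1..m}. section_zero P (F j) p))"

end

theory Submission
  imports Defs "HOL-Computational_Algebra.Fundamental_Theorem_Algebra"
begin

text \<open>
  Let \<open>S\<^sub>e\<close> be the space of polynomials with support in \<open>e P\<close> and \<open>J\<^sub>e = \<Sum>\<^sub>j F\<^sub>j S\<^sub>e\<^sub>-\<^sub>1\<close>. Homogenization of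
  \<open>\<Phi> \<in> S\<^sub>e\<close> turns the inclusions \<open>S\<^sub>e \<subseteq> S\<^sub>e\<^sub>+\<^sub>1\<close> into multiplication by the section \<open>h\<close> of the constant \<open>1\<close>,
  whose zero set is the variety at infinity. Hence the sections \<open>f\<^sub>1, ..., f\<^sub>m, h\<close> have no common
  zero, and by the Nullstellensatz on the charts of the vertices \<open>S\<^sub>e = J\<^sub>e + S\<^sub>e\<^sub>-\<^sub>1\<close> for large \<open>e\<close>, so
  \<open>S\<^sub>e = J\<^sub>e + S\<^sub>K\<close> for a fixed \<open>K\<close>. The space \<open>S\<^sub>K \<inter> (F)\<close> is finite-dimensional, so it lies in \<open>J\<^sub>\<nu>\<close>
  for some \<open>\<nu>\<close>, and then \<open>S\<^sub>e \<inter> (F) = J\<^sub>e + (S\<^sub>K \<inter> (F)) = J\<^sub>e\<close> for all \<open>e \<ge> \<nu>\<close>.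
\<close>

section \<open>The Nullstellensatz for monoid algebras\<close>

text \<open>The chart at \<open>v\<close> is replaced by the monoid generated by the differences
  \<open>y - v\<close> of lattice points of \<open>P\<close>: it is finitely generated by
  construction, and enough factors \<open>z^v\<close> carry each of its monomials into a multiple of
  \<open>P\<close>. As this monoid is not identified with the lattice points of a cone, a point
  supplied by the Nullstellensatz is not yet a point of the toric variety. It becomes one after
  being written as a character of the whole lattice cut off along a face, a form that makes sense on
  any cone containing the functional of the face.

  The passage from charts to large degrees consists of clearing denominators: the local identity for
  \<open>1\<close> at \<open>v\<close> puts \<open>z^(k v)\<close> into \<open>J_k + S_(k-1)\<close>
  for all large \<open>k\<close>. This holds at every lattice point \<open>v\<close> of
  \<open>P\<close>, hence for any finite set of lattice points with hull \<open>P\<close>, and a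
  lattice point of \<open>e P\<close> with \<open>e\<close> large contains \<open>K\<close> copies
  of one of them.

  Degrees are real because \<open>e\<close> need not be an integer. The unit vectors in
  \<open>P\<close> ensure that every polynomial lies in some \<open>S_r\<close>, so that membership
  in the ideal amounts to membership in some \<open>J_r\<close>.\<close>

abbreviation const :: "'b::zero \<Rightarrow> 'a::zero \<Rightarrow>\<^sub>0 'b" where
  "const \<equiv> Poly_Mapping.single 0"

lemma poly_mapping_sum_singles:
  "f = (\<Sum>a\<in>Poly_Mapping.keys f. Poly_Mapping.single a (Poly_Mapping.lookup f a))"
  by (intro poly_mapping_eqI) (auto simp: lookup_sum lookup_single when_def in_keys_iff)

text \<open>Scalars act through constants. This provides spans and independence for the two
  dimension counts, in \<open>residue_exists\<close> and in
  \<open>bounded_degree_uniform\<close>.\<close>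

interpretation monoid_algebra: vector_space "\<lambda>(c::'b::field) (f::'a::comm_monoid_add \<Rightarrow>\<^sub>0 'b). const c * f"
  by unfold_locales
    (simp_all add: single_add distrib_left distrib_right mult_single flip: mult.assoc)

text \<open>One notion serves two purposes: the algebra of a submonoid \<open>M\<close>, and the
  space of sections given by the lattice points of a multiple of \<open>P\<close>.\<close>

definition supported_on :: "'a set \<Rightarrow> ('a \<Rightarrow>\<^sub>0 'b::zero) set" where
  "supported_on M = {f. Poly_Mapping.keys f \<subseteq> M}"

lemma supported_on_span:
  fixes f :: "'a::comm_monoid_add \<Rightarrow>\<^sub>0 'b::field"
  assumes "f \<in> supported_on T"
  shows "f \<in> monoid_algebra.span ((\<lambda>t. Poly_Mapping.single t 1) ` T)"
proof -
  have "(\<Sum>a\<in>Poly_Mapping.keys f. const (Poly_Mapping.lookup f a) * Poly_Mapping.single a 1)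
      \<in> monoid_algebra.span ((\<lambda>t. Poly_Mapping.single t 1) ` T)"
    using assms by (intro monoid_algebra.span_sum monoid_algebra.span_scale monoid_algebra.span_base)
      (auto simp: supported_on_def)
  then show ?thesis
    by (simp add: mult_single flip: poly_mapping_sum_singles)
qed

lemma supported_on_zero: "0 \<in> supported_on M"
  by (simp add: supported_on_def)

lemma supported_on_add: "f \<in> supported_on M \<Longrightarrow> g \<in> supported_on M \<Longrightarrow> f + g \<in> supported_on M"
  using Poly_Mapping.keys_add[of f g] by (auto simp: supported_on_def)

lemma supported_on_sum: "(\<And>i. i \<in> A \<Longrightarrow> f i \<in> supported_on M) \<Longrightarrow> sum f A \<in> supported_on M"
  by (induction A rule: infinite_finite_induct)
    (auto intro: supported_on_zero supported_on_add)

lemma supported_on_single: "a \<in> M \<Longrightarrow> Poly_Mapping.single a c \<in> supported_on M"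
  by (simp add: supported_on_def)

lemma supported_on_mult:
  assumes "f \<in> supported_on A" "g \<in> supported_on B" "\<And>a b. a \<in> A \<Longrightarrow> b \<in> B \<Longrightarrow> a + b \<in> C"
  shows "f * g \<in> supported_on C"
  using assms Poly_Mapping.keys_mult[of f g] by (fastforce simp: supported_on_def)

lemma supported_on_mono: "A \<subseteq> B \<Longrightarrow> supported_on A \<subseteq> supported_on B"
  by (auto simp: supported_on_def)

section \<open>Substituting an algebra element into a complex polynomial\<close>

definition poly_eval :: "('a::comm_monoid_add \<Rightarrow>\<^sub>0 complex) \<Rightarrow> complex poly \<Rightarrow> ('a \<Rightarrow>\<^sub>0 complex)" where
  "poly_eval a p = poly (map_poly const p) a"

lemma poly_eval_0: "poly_eval a 0 = 0"
  by (simp add: poly_eval_def)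

lemma poly_eval_pCons: "poly_eval a (pCons c p) = const c + a * poly_eval a p"
  by (cases "pCons c p = 0") (auto simp: poly_eval_def map_poly_pCons)

lemma poly_eval_1: "poly_eval a 1 = 1"
  by (simp add: one_pCons poly_eval_pCons poly_eval_0)

lemma poly_eval_add: "poly_eval a (p + q) = poly_eval a p + poly_eval a q"
proof -
  have "map_poly const (p + q) = map_poly const p + (map_poly const q :: ('a \<Rightarrow>\<^sub>0 complex) poly)"
    by (intro poly_eqI) (simp add: coeff_map_poly single_add)
  then show ?thesis by (simp add: poly_eval_def)
qed

lemma poly_eval_smult: "poly_eval a (smult c p) = const c * poly_eval a p"
  by (induction p) (simp_all add: poly_eval_0 poly_eval_pCons distrib_left mult_single ac_simps)

lemma poly_eval_mult: "poly_eval a (p * q) = poly_eval a p * poly_eval a q"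
  by (induction p) (simp_all add: poly_eval_0 poly_eval_add poly_eval_pCons poly_eval_smult algebra_simps)

lemma poly_eval_sum: "poly_eval a (sum f A) = (\<Sum>i\<in>A. poly_eval a (f i))"
  by (induction A rule: infinite_finite_induct) (simp_all add: poly_eval_0 poly_eval_add)

lemma poly_eval_prod: "poly_eval a (prod f A) = (\<Prod>i\<in>A. poly_eval a (f i))"
  by (induction A rule: infinite_finite_induct) (simp_all add: poly_eval_1 poly_eval_mult)

section \<open>Proper and maximal ideals of a monoid algebra\<close>

text \<open>The ring is a subset of a type because \<open>M\<close> will vary with the lattice point
  \<open>v\<close>.\<close>

locale monoid_algebra_ideal =
  fixes M :: "'a::comm_monoid_add set"
    and I :: "('a \<Rightarrow>\<^sub>0 complex) set"
  assumes zero_M: "0 \<in> M"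
    and add_M: "\<And>a b. a \<in> M \<Longrightarrow> b \<in> M \<Longrightarrow> a + b \<in> M"
    and subset: "I \<subseteq> supported_on M"
    and zero_I: "0 \<in> I"
    and add_I: "\<And>f g. f \<in> I \<Longrightarrow> g \<in> I \<Longrightarrow> f + g \<in> I"
    and mult_I: "\<And>f g. f \<in> I \<Longrightarrow> g \<in> supported_on M \<Longrightarrow> f * g \<in> I"
    and proper: "1 \<notin> I"
begin

abbreviation R :: "('a \<Rightarrow>\<^sub>0 complex) set" where "R \<equiv> supported_on M"

lemma R_const: "const c \<in> R"
  by (simp add: supported_on_single zero_M)

lemma R_one: "1 \<in> R"
  using R_const[of 1] by simp

lemma R_mult: "f \<in> R \<Longrightarrow> g \<in> R \<Longrightarrow> f * g \<in> R"
  by (rule supported_on_mult[where A = M and B = M]) (auto intro: add_M)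

lemma R_uminus: "f \<in> R \<Longrightarrow> - f \<in> R"
  by (simp add: supported_on_def)

lemma R_diff: "f \<in> R \<Longrightarrow> g \<in> R \<Longrightarrow> f - g \<in> R"
  using supported_on_add[OF _ R_uminus, of f g] by simp

lemma R_prod: "(\<And>i. i \<in> A \<Longrightarrow> f i \<in> R) \<Longrightarrow> prod f A \<in> R"
  by (induction A rule: infinite_finite_induct) (auto intro: R_one R_mult)

lemma uminus_I: "f \<in> I \<Longrightarrow> - f \<in> I"
  using mult_I[of f "- 1"] R_uminus[OF R_one] by simp

lemma diff_I: "f \<in> I \<Longrightarrow> g \<in> I \<Longrightarrow> f - g \<in> I"
  using add_I[OF _ uminus_I, of f g] by simp

lemma sum_I: "(\<And>i. i \<in> A \<Longrightarrow> f i \<in> I) \<Longrightarrow> sum f A \<in> I"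
  by (induction A rule: infinite_finite_induct) (auto intro: zero_I add_I)

lemma const_I:
  assumes "const c \<in> I"
  shows "c = 0"
proof (rule ccontr)
  assume "c \<noteq> 0"
  then show False
    using mult_I[OF assms R_const, of "inverse c"] proper by (simp add: mult_single)
qed

end

text \<open>
  The Nullstellensatz over an uncountable field: if \<open>a - c\<close> were invertible modulo a maximal ideal
  for every constant \<open>c\<close>, then uncountably many inverses would lie in an algebra of countable
  dimension, and a linear relation between them would make \<open>a\<close> algebraic over \<open>\<complex>\<close>.
\<close>

locale monoid_algebra_max_ideal = monoid_algebra_ideal M I
  for M :: "'a::comm_monoid_add set" and I :: "('a \<Rightarrow>\<^sub>0 complex) set" +
  assumes countable: "countable M"
    and maximal: "\<And>J. monoid_algebra_ideal M J \<Longrightarrow> I \<subseteq> J \<Longrightarrow> J = I"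
begin

text \<open>Adjoining \<open>a\<close> to the maximal ideal must produce \<open>1\<close>, and the
  cofactor of \<open>a\<close> in such a representation of \<open>1\<close> is the inverse.\<close>

lemma inverse_mod:
  assumes a: "a \<in> R" "a \<notin> I"
  obtains b where "b \<in> R" "a * b - 1 \<in> I"
proof -
  define J where "J = {x + a * r | x r. x \<in> I \<and> r \<in> R}"
  have "I \<subseteq> J" unfolding J_def
    using supported_on_zero[of M] by force
  have aJ: "a \<in> J" unfolding J_def
    using zero_I R_one by force
  have "1 \<in> J"
  proof (rule ccontr)
    assume "1 \<notin> J"
    have "monoid_algebra_ideal M J"
    proof
      show "J \<subseteq> R" unfolding J_def
        using subset a by (auto intro!: supported_on_add R_mult)
      show "f + g \<in> J" if fg: "f \<in> J" "g \<in> J" for f g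
      proof -
        obtain x r y s where "x \<in> I" "r \<in> R" "y \<in> I" "s \<in> R" "f = x + a * r" "g = y + a * s"
          using fg by (auto simp: J_def)
        moreover have "f + g = (x + y) + a * (r + s)"
          by (simp add: calculation algebra_simps)
        ultimately show ?thesis unfolding J_def
          using add_I supported_on_add by blast
      qed
      show "f * g \<in> J" if fg: "f \<in> J" "g \<in> R" for f g
      proof -
        obtain x r where "x \<in> I" "r \<in> R" "f = x + a * r"
          using fg by (auto simp: J_def)
        moreover have "f * g = (x * g) + a * (r * g)"
          by (simp add: calculation algebra_simps)
        ultimately show ?thesis unfolding J_def
          using mult_I R_mult fg by blast
      qed
    qed (use \<open>I \<subseteq> J\<close> \<open>1 \<notin> J\<close> zero_I zero_M add_M in auto)
    with maximal \<open>I \<subseteq> J\<close> aJ a show False by blast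
  qed
  then obtain x r where x: "x \<in> I" "r \<in> R" "1 = x + a * r"
    by (auto simp: J_def)
  then have "a * r - 1 = - x" by (simp add: algebra_simps)
  with x uminus_I that show ?thesis by metis
qed

lemma prime:
  assumes "a \<in> R" "b \<in> R" "a * b \<in> I"
  shows "a \<in> I \<or> b \<in> I"
proof (rule ccontr)
  assume *: "\<not> ?thesis"
  then obtain c where c: "c \<in> R" "a * c - 1 \<in> I" using assms inverse_mod by blast
  have "b = (a * b) * c - (a * c - 1) * b" by (simp add: algebra_simps)
  also have "\<dots> \<in> I" using diff_I[OF mult_I[OF assms(3) c(1)] mult_I[OF c(2) assms(2)]] .
  finally show False using * by simp
qed

lemma poly_eval_R:
  assumes "a \<in> R"
  shows "poly_eval a p \<in> R"
  by (induction p) (simp_all add: poly_eval_0 poly_eval_pCons assms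
      supported_on_zero supported_on_add R_const R_mult)

text \<open>Over the complex numbers \<open>p\<close> splits into linear factors, and since
  \<open>I\<close> is prime, one of them evaluates into \<open>I\<close>.\<close>

lemma root_mod:
  assumes a: "a \<in> R" and p: "p \<noteq> 0" "poly_eval a p \<in> I"
  shows "\<exists>c. a - const c \<in> I"
  using p
proof (induction "degree p" arbitrary: p)
  case 0
  then obtain c where "p = [:c:]" "c \<noteq> 0" by (metis degree_eq_zeroE pCons_0_0)
  with 0 show ?case using const_I by (auto simp: poly_eval_pCons poly_eval_0)
next
  case (Suc n)
  then obtain r where "poly p r = 0"
    using fundamental_theorem_of_algebra[of p] by (metis constant_degree nat.distinct(1))
  then obtain q where q: "p = [:-r, 1:] * q" by (metis dvdE poly_eq_0_iff_dvd)
  with Suc have "n = degree q" "q \<noteq> 0" by (auto simp: degree_mult_eq simp del: mult_pCons_left)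
  moreover have "poly_eval a [:-r, 1:] = a - const r"
    by (simp add: poly_eval_pCons poly_eval_0 single_uminus)
  ultimately show ?case
    using prime[of "a - const r" "poly_eval a q"] Suc a q
    by (metis R_const R_diff poly_eval_R poly_eval_mult)
qed

lemma residue_exists:
  assumes a: "a \<in> R"
  shows "\<exists>c. a - const c \<in> I"
proof (rule ccontr)
  assume no: "\<nexists>c. a - const c \<in> I"
  have "\<exists>b. b \<in> R \<and> (a - const c) * b - 1 \<in> I" for c
    using inverse_mod[of "a - const c"] no R_diff[OF a R_const] by metis
  then obtain b where b: "\<And>c. b c \<in> R" "\<And>c. (a - const c) * b c - 1 \<in> I"
    by metis
  \<comment> \<open>If two constants shared an inverse, the difference of their relations would be a
    nonzero multiple of it. The inverse, and with it \<open>1\<close>, would lie in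
    \<open>I\<close>.\<close>
  have inj: "inj b"
  proof (rule injI, rule ccontr)
    fix c d assume "b c = b d" "c \<noteq> d"
    then have "((a - const d) * b d - 1) - ((a - const c) * b c - 1) = b c * const (c - d)"
      by (simp add: algebra_simps single_diff)
    then have "b c * const (c - d) \<in> I" using b diff_I by metis
    then have "b c * const (c - d) * const (inverse (c - d)) \<in> I"
      using mult_I R_const by blast
    then have "b c \<in> I" using \<open>c \<noteq> d\<close> by (simp add: mult.assoc mult_single)
    then have "b c * (a - const c) - ((a - const c) * b c - 1) \<in> I"
      using b R_diff[OF a R_const] mult_I diff_I by blast
    then show False using proper by (simp add: algebra_simps)
  qed
  \<comment> \<open>The supports are finite subsets of the countable set \<open>M\<close>, while
    there are uncountably many \<open>c\<close>. Hence some support \<open>T\<close> is shared by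
    infinitely many inverses, and \<open>card T + 1\<close> of these are linearly dependent.\<close>
  define K where "K = (\<lambda>c. Poly_Mapping.keys (b c))"
  have "K c \<in> {T. finite T \<and> T \<subseteq> M}" for c
    using b(1)[of c] by (auto simp: K_def supported_on_def)
  moreover have "countable {T. finite T \<and> T \<subseteq> M}"
    using countable by (simp add: countable_Collect_finite_subset)
  ultimately have "countable (K ` UNIV)"
    by (metis (no_types, lifting) countable_subset image_subsetI)
  have "\<exists>T\<in>range K. infinite (K -` {T})"
  proof (rule ccontr)
    assume "\<not> ?thesis"
    then have "countable (\<Union>T\<in>range K. K -` {T})"
      using \<open>countable (K ` UNIV)\<close> by (intro countable_UN) (auto intro: countable_finite)
    moreover have "(\<Union>T\<in>range K. K -` {T}) = UNIV" by auto
    moreover have "uncountable (UNIV :: complex set)"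
    proof
      assume "countable (UNIV :: complex set)"
      then have "countable (range complex_of_real)" using countable_subset subset_UNIV by blast
      then show False
        using uncountable_UNIV_real inj_of_real countable_image_inj_on by blast
    qed
    ultimately show False by simp
  qed
  then obtain T where T: "T \<in> range K" "infinite (K -` {T})" by blast
  from T(1) have "finite T" by (auto simp: K_def)
  obtain X where X: "X \<subseteq> K -` {T}" "finite X" "card X = Suc (card T)"
    using infinite_arbitrarily_large[OF T(2), of "Suc (card T)"] by blast
  have "monoid_algebra.dependent (b ` X)"
  proof (rule ccontr)
    assume ind: "monoid_algebra.independent (b ` X)"
    have "b c \<in> supported_on T" if "c \<in> X" for c
      using X that by (auto simp: supported_on_def K_def)
    then have "b ` X \<subseteq> monoid_algebra.span ((\<lambda>t. Poly_Mapping.single t 1) ` T)"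
      using supported_on_span by blast
    from monoid_algebra.independent_span_bound[OF _ ind this]
    have "card (b ` X) \<le> card ((\<lambda>t. Poly_Mapping.single t (1::complex)) ` T)"
      using \<open>finite T\<close> by simp
    also have "\<dots> \<le> card T" using \<open>finite T\<close> by (rule card_image_le)
    finally show False using X inj by (simp add: card_image inj_on_subset)
  qed
  then obtain \<beta> y where dep: "(\<Sum>v\<in>b ` X. const (\<beta> v) * v) = 0" "y \<in> b ` X" "\<beta> y \<noteq> 0"
    using monoid_algebra.dependent_finite[of "b ` X"] X by blast
  then obtain d where d: "d \<in> X" "\<beta> (b d) \<noteq> 0" by blast
  have rel: "(\<Sum>c\<in>X. const (\<beta> (b c)) * b c) = 0"
    using dep(1) inj by (simp add: sum.reindex inj_on_subset)
  \<comment> \<open>Multiplying the linear relation by the product of all \<open>a - const d\<close>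
    and replacing \<open>(a - const c) * b c\<close> by \<open>1\<close> modulo \<open>I\<close>
    yields \<open>p\<close> evaluated at \<open>a\<close>. Since \<open>q c\<close> omits only the
    root \<open>c\<close>, a single term of \<open>p\<close> survives at each point of
    \<open>X\<close>, which makes \<open>p\<close> nonzero.\<close>
  define q where "q c = (\<Prod>d\<in>X - {c}. [:-d, 1:])" for c :: complex
  define p where "p = (\<Sum>c\<in>X. smult (\<beta> (b c)) (q c))"
  have "poly p d = (\<Sum>c\<in>X. if c = d then \<beta> (b d) * poly (q d) d else 0)"
    unfolding p_def poly_sum using X d
    by (intro sum.cong) (auto simp: q_def poly_prod)
  then have "poly p d = \<beta> (b d) * poly (q d) d" using X d by simp
  moreover have "poly (q d) d \<noteq> 0" using X by (auto simp: q_def poly_prod)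
  ultimately have "p \<noteq> 0" using d by auto
  moreover have "poly_eval a p \<in> I"
  proof -
    define Q where "Q c = (\<Prod>d\<in>X - {c}. a - const d)" for c
    have QR: "Q c \<in> R" for c
      unfolding Q_def using a by (intro R_prod R_diff R_const)
    have q: "poly_eval a (q c) = Q c" for c
      by (simp add: q_def Q_def poly_eval_prod poly_eval_pCons poly_eval_0 single_uminus)
    have split: "(\<Prod>d\<in>X. a - const d) = (a - const c) * Q c" if "c \<in> X" for c
      unfolding Q_def using X that by (simp add: prod.remove)
    have "0 = (\<Sum>c\<in>X. const (\<beta> (b c)) * b c) * (\<Prod>d\<in>X. a - const d)"
      using rel by simp
    also have "\<dots> = (\<Sum>c\<in>X. const (\<beta> (b c)) * b c * ((a - const c) * Q c))"
      using split by (simp add: sum_distrib_right)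
    finally have "poly_eval a p =
        (\<Sum>c\<in>X. const (\<beta> (b c)) * Q c) - (\<Sum>c\<in>X. const (\<beta> (b c)) * b c * ((a - const c) * Q c))"
      by (simp add: p_def poly_eval_sum poly_eval_smult q)
    also have "\<dots> = - (\<Sum>c\<in>X. ((a - const c) * b c - 1) * (const (\<beta> (b c)) * Q c))"
      by (simp add: algebra_simps flip: sum_subtractf sum_negf)
    also have "\<dots> \<in> I"
      by (intro uminus_I sum_I mult_I b R_mult R_const QR)
    finally show ?thesis .
  qed
  ultimately show False using root_mod[OF a] no by blast
qed

text \<open>The residue constant is unique because a proper ideal contains no nonzero constant.
  Uniqueness turns the closure properties of \<open>I\<close> into the homomorphism laws.\<close>

lemma algebra_hom_exists_max:
  obtains \<phi> :: "('a \<Rightarrow>\<^sub>0 complex) \<Rightarrow> complex"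
  where "\<And>c. \<phi> (const c) = c"
    and "\<And>f g. f \<in> R \<Longrightarrow> g \<in> R \<Longrightarrow> \<phi> (f + g) = \<phi> f + \<phi> g"
    and "\<And>f g. f \<in> R \<Longrightarrow> g \<in> R \<Longrightarrow> \<phi> (f * g) = \<phi> f * \<phi> g"
    and "\<And>f. f \<in> I \<Longrightarrow> \<phi> f = 0"
proof -
  define \<phi> where "\<phi> f = (SOME c. f - const c \<in> I)" for f
  have \<phi>: "f - const (\<phi> f) \<in> I" if "f \<in> R" for f
    unfolding \<phi>_def using residue_exists[OF that] by (rule someI_ex)
  have uniq: "\<phi> f = c" if "f \<in> R" "f - const c \<in> I" for f c
  proof -
    have "(f - const c) - (f - const (\<phi> f)) = const (\<phi> f - c)" by (simp add: single_diff)
    then show ?thesis using diff_I[OF that(2) \<phi>[OF that(1)]] const_I by fastforce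
  qed
  show thesis
  proof (rule that)
    show "\<phi> (const c) = c" for c using uniq[of "const c" c] R_const zero_I by simp
    show "\<phi> f = 0" if "f \<in> I" for f using uniq[of f 0] that subset by auto
    fix f g assume fg: "f \<in> R" "g \<in> R"
    have "f + g - const (\<phi> f + \<phi> g) = (f - const (\<phi> f)) + (g - const (\<phi> g))"
      by (simp add: single_add algebra_simps)
    also have "\<dots> \<in> I" using fg by (intro add_I \<phi>)
    finally show "\<phi> (f + g) = \<phi> f + \<phi> g" using fg uniq supported_on_add by blast
    have "f * g - const (\<phi> f * \<phi> g) = (f - const (\<phi> f)) * g + (g - const (\<phi> g)) * const (\<phi> f)"
      by (simp add: mult_single algebra_simps)
    also have "\<dots> \<in> I" using fg by (intro add_I mult_I \<phi> R_const)
    finally show "\<phi> (f * g) = \<phi> f * \<phi> g" using fg uniq R_mult by blast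
  qed
qed

end

context monoid_algebra_ideal
begin

text \<open>Zorn's lemma reduces this to a maximal ideal: the union of a chain of proper ideals
  still omits \<open>1\<close>.\<close>

lemma algebra_hom_exists:
  assumes "countable M"
  obtains \<phi> :: "('a \<Rightarrow>\<^sub>0 complex) \<Rightarrow> complex"
  where "\<And>c. \<phi> (const c) = c"
    and "\<And>f g. f \<in> R \<Longrightarrow> g \<in> R \<Longrightarrow> \<phi> (f + g) = \<phi> f + \<phi> g"
    and "\<And>f g. f \<in> R \<Longrightarrow> g \<in> R \<Longrightarrow> \<phi> (f * g) = \<phi> f * \<phi> g"
    and "\<And>f. f \<in> I \<Longrightarrow> \<phi> f = 0"
proof -
  define A where "A = {J. monoid_algebra_ideal M J \<and> I \<subseteq> J}"
  have "\<exists>J\<in>A. \<forall>K\<in>A. J \<subseteq> K \<longrightarrow> K = J"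
  proof (rule subset_Zorn_nonempty)
    show "A \<noteq> {}" unfolding A_def using monoid_algebra_ideal_axioms by blast
    fix \<C> assume "\<C> \<noteq> {}" and chain: "subset.chain A \<C>"
    then have id: "monoid_algebra_ideal M J" "I \<subseteq> J" if "J \<in> \<C>" for J
      using that by (auto simp: A_def subset.chain_def)
    have "monoid_algebra_ideal M (\<Union>\<C>)"
    proof (rule monoid_algebra_ideal.intro)
      fix f g assume "f \<in> \<Union>\<C>" "g \<in> \<Union>\<C>"
      then obtain J K where JK: "f \<in> J" "g \<in> K" "J \<in> \<C>" "K \<in> \<C>" by blast
      then have "J \<subseteq> K \<or> K \<subseteq> J" using chain by (auto simp: subset.chain_def)
      with JK obtain L where "L \<in> \<C>" "f \<in> L" "g \<in> L" by blast
      then have "f + g \<in> L" using monoid_algebra_ideal.add_I[OF id(1)] by blast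
      then show "f + g \<in> \<Union>\<C>" using \<open>L \<in> \<C>\<close> by blast
    next
      show "f * g \<in> \<Union>\<C>" if "f \<in> \<Union>\<C>" "g \<in> R" for f g
        using that monoid_algebra_ideal.mult_I[OF id(1)] by (metis Union_iff)
      show "\<Union>\<C> \<subseteq> R" using monoid_algebra_ideal.subset[OF id(1)] by (rule Union_least)
      show "0 \<in> \<Union>\<C>" using id(2) zero_I \<open>\<C> \<noteq> {}\<close> by blast
      show "1 \<notin> \<Union>\<C>" using monoid_algebra_ideal.proper[OF id(1)] by blast
    qed (use zero_M add_M in auto)
    then show "\<Union>\<C> \<in> A" unfolding A_def using id(2) \<open>\<C> \<noteq> {}\<close> by blast
  qed
  then obtain J where JA: "J \<in> A" "\<forall>K\<in>A. J \<subseteq> K \<longrightarrow> K = J" by (rule bexE)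
  then have J: "monoid_algebra_ideal M J" "I \<subseteq> J" by (simp_all add: A_def)
  have max: "K = J" if "monoid_algebra_ideal M K" "J \<subseteq> K" for K
    using JA(2) J(2) that by (auto simp: A_def)
  interpret J: monoid_algebra_ideal M J by fact
  interpret J: monoid_algebra_max_ideal M J
    using assms max by unfold_locales
  show thesis
  proof (rule J.algebra_hom_exists_max)
    fix \<phi> :: "('a \<Rightarrow>\<^sub>0 complex) \<Rightarrow> complex"
    assume "\<And>c. \<phi> (const c) = c"
      "\<And>f g. f \<in> R \<Longrightarrow> g \<in> R \<Longrightarrow> \<phi> (f + g) = \<phi> f + \<phi> g"
      "\<And>f g. f \<in> R \<Longrightarrow> g \<in> R \<Longrightarrow> \<phi> (f * g) = \<phi> f * \<phi> g"
      "\<And>f. f \<in> J \<Longrightarrow> \<phi> f = 0"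
    with J(2) show thesis by (intro that[of \<phi>]) blast+
  qed
qed

end

section \<open>Points of affine toric charts\<close>

lemma real_vec_zero [simp]: "real_vec 0 = 0"
  by (simp add: real_vec_def vec_eq_iff)

lemma real_vec_add: "real_vec (a + b) = real_vec a + real_vec b"
  by (simp add: real_vec_def vec_eq_iff)

lemma real_vec_uminus: "real_vec (- a) = - real_vec a"
  by (simp add: real_vec_def vec_eq_iff)

lemma real_vec_diff: "real_vec (a - b) = real_vec a - real_vec b"
  by (simp add: real_vec_def vec_eq_iff)

text \<open>
  By simultaneous Dirichlet approximation some multiple \<open>q c\<close> is so close to integers \<open>p\<close> that the
  lattice vector \<open>\<Sum> p\<^sub>d d\<close> has entries of absolute value below \<open>1\<close>.
\<close>

lemma integral_relation:
  fixes D :: "(int ^ 'n::finite) set" and c :: "int ^ 'n \<Rightarrow> real"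
  assumes D: "finite D" and rel: "(\<Sum>d\<in>D. c d *\<^sub>R real_vec d) = 0"
  obtains p :: "int ^ 'n \<Rightarrow> int"
  where "(\<Sum>d\<in>D. p d *s d) = 0"
    and "\<And>d. d \<in> D \<Longrightarrow> 0 \<le> c d \<Longrightarrow> 0 \<le> p d"
    and "\<And>d. d \<in> D \<Longrightarrow> 0 < c d \<Longrightarrow> 0 < p d"
proof -
  obtain h where h: "bij_betw h {0..<card D} D" using ex_bij_betw_nat_finite[OF D] by blast
  define B where "B i = (\<Sum>d\<in>D. \<bar>real_of_int (d $ i)\<bar>)" for i
  \<comment> \<open>\<open>N\<close> exceeds every \<open>B i\<close>, which keeps the accumulated
    error below \<open>1\<close>, and every \<open>1 / c d\<close>, which makes \<open>p d\<close>
    positive when \<open>c d\<close> is. Terms with \<open>c d = 0\<close> contribute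
    \<open>0\<close> to the second sum.\<close>
  obtain N :: nat where N: "(\<Sum>i\<in>UNIV. B i) + (\<Sum>d\<in>D. \<bar>1 / c d\<bar>) < real N"
    using reals_Archimedean2 by blast
  have B0: "0 \<le> B i" for i unfolding B_def by (simp add: sum_nonneg)
  have sB0: "0 \<le> (\<Sum>i\<in>UNIV. B i)" "0 \<le> (\<Sum>d\<in>D. \<bar>1 / c d\<bar>)" 
    using B0 by (auto intro: sum_nonneg)
  have N0: "0 < real N" using N sB0 by linarith
  have NB: "B i < real N" for i
    using N sB0 member_le_sum[of i UNIV B] B0 by simp
  have Nc: "1 / N < c d" if "d \<in> D" "0 < c d" for d
  proof -
    have "1 / c d \<le> (\<Sum>d\<in>D. \<bar>1 / c d\<bar>)"
      using member_le_sum[of d D "\<lambda>d. \<bar>1 / c d\<bar>"] that D by simp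
    then have "1 / c d < N" using N sB0 by linarith
    then show ?thesis using that N0 by (simp add: field_simps)
  qed
  obtain q p' where q: "0 < q" and
    p': "\<And>i. i < card D \<Longrightarrow> \<bar>of_int q * c (h i) - of_int (p' i)\<bar> < 1 / N"
  proof (rule Dirichlet_approx_simult[of N "card D" "c \<circ> h"])
    show "N > 0" using N0 by simp
  qed auto
  define p where "p d = p' (inv_into {0..<card D} h d)" for d
  have p: "\<bar>of_int q * c d - of_int (p d)\<bar> < 1 / N" if "d \<in> D" for d
  proof -
    have "inv_into {0..<card D} h d < card D" "h (inv_into {0..<card D} h d) = d"
      using h that inv_into_into[of d h "{0..<card D}"] by (auto simp: bij_betw_def f_inv_into_f)
    then show ?thesis using p' unfolding p_def by metis
  qed
  have qc: "c d \<le> of_int q * c d" if "0 \<le> c d" for d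
    using q that mult_right_mono[of 1 "of_int q" "c d"] by simp
  have N1: "1 / real N \<le> 1" using N0 by simp
  show thesis
  proof (rule that)
    show "0 \<le> p d" if "d \<in> D" "0 \<le> c d" for d
      using p[OF that(1)] qc[OF that(2)] that N1 by linarith
    show "0 < p d" if "d \<in> D" "0 < c d" for d
      using p[OF that(1)] qc[of d] Nc[OF that] that by linarith
    have "(\<Sum>d\<in>D. p d * d $ i) = 0" for i
    proof -
      have rel_i: "(\<Sum>d\<in>D. c d * d $ i) = 0"
        using arg_cong[OF rel, of "\<lambda>v. v $ i"] by (simp add: real_vec_def)
      \<comment> \<open>Subtracting \<open>q\<close> times the given relation changes nothing and
        leaves only the approximation errors as coefficients.\<close>
      have "\<bar>real_of_int (\<Sum>d\<in>D. p d * d $ i)\<bar> = \<bar>\<Sum>d\<in>D. (of_int (p d) - of_int q * c d) * d $ i\<bar>"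
        using rel_i by (simp add: left_diff_distrib sum_subtractf mult.assoc flip: sum_distrib_left)
      also have "\<dots> \<le> (\<Sum>d\<in>D. \<bar>(of_int (p d) - of_int q * c d) * d $ i\<bar>)"
        by (rule sum_abs)
      also have "\<dots> \<le> (\<Sum>d\<in>D. 1 / N * \<bar>real_of_int (d $ i)\<bar>)"
        unfolding abs_mult using p
        by (intro sum_mono mult_right_mono) (auto simp: abs_minus_commute intro: less_imp_le)
      also have "\<dots> = 1 / N * B i" by (simp add: B_def sum_distrib_left)
      also have "\<dots> < 1" using NB N0 by (simp add: field_simps)
      finally show ?thesis by linarith
    qed
    then show "(\<Sum>d\<in>D. p d *s d) = 0"
      by (simp add: vec_eq_iff)
  qed
qed

section \<open>Extending characters from subgroups to the whole lattice\<close>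

text \<open>A homomorphism from a subgroup to the nonzero complex numbers; differences and quotients
  encode the subgroup and homomorphism laws together.\<close>

definition character_on :: "(int ^ 'n::finite) set \<Rightarrow> (int ^ 'n \<Rightarrow> complex) \<Rightarrow> bool" where
  "character_on H \<kappa> \<longleftrightarrow> 0 \<in> H \<and> (\<forall>x\<in>H. \<kappa> x \<noteq> 0) \<and>
     (\<forall>x\<in>H. \<forall>y\<in>H. x - y \<in> H \<and> \<kappa> (x - y) = \<kappa> x / \<kappa> y)"

lemma character_on_zero:
  assumes "character_on H \<kappa>"
  shows "0 \<in> H" "\<kappa> 0 = 1"
proof -
  show "0 \<in> H" using assms by (simp add: character_on_def)
  with assms have "\<kappa> (0 - 0) = \<kappa> 0 / \<kappa> 0" "\<kappa> 0 \<noteq> 0" unfolding character_on_def by blast+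
  then show "\<kappa> 0 = 1" by simp
qed

lemma character_on_diff:
  assumes "character_on H \<kappa>" "x \<in> H" "y \<in> H"
  shows "x - y \<in> H" "\<kappa> (x - y) = \<kappa> x / \<kappa> y"
  using assms by (auto simp: character_on_def)

lemma character_on_add:
  assumes "character_on H \<kappa>" "x \<in> H" "y \<in> H"
  shows "x + y \<in> H" "\<kappa> (x + y) = \<kappa> x * \<kappa> y"
  using character_on_diff[OF assms(1,2) character_on_diff(1)[OF assms(1) _ assms(3)], of 0]
    character_on_diff(2)[OF assms(1) _ assms(3), of 0] character_on_zero[OF assms(1)]
  by simp_all

lemma character_on_nonzero: "character_on H \<kappa> \<Longrightarrow> x \<in> H \<Longrightarrow> \<kappa> x \<noteq> 0"
  by (simp add: character_on_def)

lemma character_on_scale: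
  assumes \<kappa>: "character_on H \<kappa>" and h: "h \<in> H"
  shows "k *s h \<in> H \<and> \<kappa> (k *s h) = \<kappa> h powi k"
proof (induction k rule: int_induct[of _ 0])
  case base
  then show ?case using character_on_zero[OF \<kappa>] by simp
next
  case (step1 i)
  then show ?case
    using character_on_add[OF \<kappa> _ h, of "i *s h"] character_on_nonzero[OF \<kappa> h]
    by (simp add: vector_sadd_rdistrib power_int_add_1)
next
  case (step2 i)
  then show ?case
    using character_on_diff[OF \<kappa> _ h, of "i *s h"] character_on_nonzero[OF \<kappa> h]
    by (simp add: vector_sub_rdistrib power_int_diff)
qed

text \<open>This uses that \<open>\<complex>\<^sup>\<times>\<close> is divisible.\<close>

lemma character_on_extend_one:
  assumes \<kappa>: "character_on H \<kappa>"
  obtains H' \<kappa>' where "character_on H' \<kappa>'" "H \<subseteq> H'" "g \<in> H'" "\<And>x. x \<in> H \<Longrightarrow> \<kappa>' x = \<kappa> x"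
proof -
  \<comment> \<open>The value \<open>c\<close> for \<open>g\<close> must agree with
    \<open>\<kappa>\<close> on the multiples of \<open>g\<close> that already lie in
    \<open>H\<close>. If only the zero multiple does, \<open>1\<close> can be taken.\<close>
  have "\<exists>c. c \<noteq> 0 \<and> (\<forall>k. k *s g \<in> H \<longrightarrow> \<kappa> (k *s g) = c powi k)"
  proof (cases "\<exists>n>0. int n *s g \<in> H")
    case False
    have "k = 0" if "k *s g \<in> H" for k
    proof (rule ccontr)
      assume "k \<noteq> 0"
      moreover have "(- k) *s g \<in> H"
        using character_on_diff(1)[OF \<kappa> character_on_zero(1)[OF \<kappa>] that]
        by (simp add: vector_sneg_minus1)
      ultimately show False using False that
        by (metis int_cases3 neg_0_less_iff_less of_nat_0_less_iff minus_minus)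
    qed
    then have "k *s g \<in> H \<longrightarrow> \<kappa> (k *s g) = 1 powi k" for k
      using character_on_zero[OF \<kappa>] by (cases "k = 0") auto
    then show ?thesis by (intro exI[of _ 1]) simp
  next
    case True
    \<comment> \<open>Division with remainder shows that the multiples of \<open>g\<close> in
      \<open>H\<close> are those of \<open>int n *s g\<close>, so an \<open>n\<close>-th root of its
      value is the right choice.\<close>
    define n where "n = (LEAST n. 0 < n \<and> int n *s g \<in> H)"
    have n: "0 < n" "int n *s g \<in> H"
      using LeastI_ex[OF True] unfolding n_def by auto
    have least: "n \<le> m" if "0 < m" "int m *s g \<in> H" for m
      using that unfolding n_def by (intro Least_le) auto
    define c where "c = exp (Ln (\<kappa> (int n *s g)) / of_nat n)"
    have c: "c ^ n = \<kappa> (int n *s g)"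
      using n character_on_nonzero[OF \<kappa>] by (simp add: c_def flip: exp_of_nat_mult)
    have "\<kappa> (k *s g) = c powi k" if k: "k *s g \<in> H" for k
    proof -
      have eq: "(k div int n) *s (int n *s g) = (k div int n * int n) *s g"
        by (simp add: vector_smult_assoc)
      then have "k *s g - (k div int n * int n) *s g \<in> H"
        using character_on_diff(1)[OF \<kappa> k] character_on_scale[OF \<kappa> n(2)] by metis
      then have "(k mod int n) *s g \<in> H"
        by (simp add: minus_div_mult_eq_mod flip: vector_sub_rdistrib)
      then have "int (nat (k mod int n)) *s g \<in> H" using n by simp
      then have "nat (k mod int n) = 0"
        using least[of "nat (k mod int n)"] n pos_mod_bound[of "int n" k] by linarith
      then have "k mod int n = 0" using n pos_mod_sign[of "int n" k] by linarith
      then have k: "k = k div int n * int n" by (simp add: mod_0_imp_dvd)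
      have "\<kappa> (k *s g) = \<kappa> (int n *s g) powi (k div int n)"
        using k eq character_on_scale[OF \<kappa> n(2)] by metis
      also have "\<dots> = c powi (int n * (k div int n))"
        by (simp add: power_int_mult flip: c)
      finally show ?thesis using k by (simp add: mult.commute)
    qed
    then show ?thesis by (intro exI[of _ c]) (simp add: c_def)
  qed
  then obtain c where c: "c \<noteq> 0" "\<And>k. k *s g \<in> H \<Longrightarrow> \<kappa> (k *s g) = c powi k" by blast
  define H' where "H' = {x. \<exists>k. x - k *s g \<in> H}"
  \<comment> \<open>An element of \<open>H'\<close> can be an element of \<open>H\<close> plus a
    multiple of \<open>g\<close> in several ways. \<open>k\<close> selects one, and the fact
    \<open>\<kappa>'\<close> shows that the value does not depend on it.\<close>
  define k where "k x = (SOME k. x - k *s g \<in> H)" for x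
  define \<kappa>' where "\<kappa>' x = \<kappa> (x - k x *s g) * c powi k x" for x
  have \<kappa>': "\<kappa>' x = \<kappa> (x - l *s g) * c powi l" if l: "x - l *s g \<in> H" for x l
  proof -
    have kx: "x - k x *s g \<in> H" unfolding k_def using l by (rule someI)
    have eq: "(x - k x *s g) - (x - l *s g) = (l - k x) *s g"
      by (simp add: vector_sub_rdistrib)
    have "\<kappa> (x - k x *s g) / \<kappa> (x - l *s g) = c powi (l - k x)"
      using character_on_diff[OF \<kappa> kx l, unfolded eq] c(2)[of "l - k x"] by metis
    then show ?thesis
      using c(1) character_on_nonzero[OF \<kappa> l] by (simp add: \<kappa>'_def power_int_diff field_simps)
  qed
  have "character_on H' \<kappa>'"
    unfolding character_on_def
  proof (intro conjI ballI)
    show "0 \<in> H'" unfolding H'_def using character_on_zero[OF \<kappa>] by (auto intro!: exI[of _ 0])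
    fix x assume "x \<in> H'"
    then obtain a where a: "x - a *s g \<in> H" by (auto simp: H'_def)
    show "\<kappa>' x \<noteq> 0" using \<kappa>'[OF a] c(1) character_on_nonzero[OF \<kappa> a] by simp
    fix y assume "y \<in> H'"
    then obtain b where b: "y - b *s g \<in> H" by (auto simp: H'_def)
    have eq: "(x - a *s g) - (y - b *s g) = (x - y) - (a - b) *s g"
      by (simp add: vector_sub_rdistrib)
    note d = character_on_diff[OF \<kappa> a b, unfolded eq]
    show "x - y \<in> H'" using d(1) unfolding H'_def by blast
    show "\<kappa>' (x - y) = \<kappa>' x / \<kappa>' y"
      unfolding \<kappa>'[OF d(1)] \<kappa>'[OF a] \<kappa>'[OF b] d(2) using c(1) by (simp add: power_int_diff)
  qed
  moreover have "H \<subseteq> H'" unfolding H'_def by (auto intro!: exI[of _ 0])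
  moreover have "g \<in> H'"
    unfolding H'_def using character_on_zero[OF \<kappa>] by (auto intro!: exI[of _ 1])
  moreover have "\<kappa>' x = \<kappa> x" if "x \<in> H" for x
    using \<kappa>'[of x 0] that by simp
  ultimately show thesis by (rule that)
qed

lemma character_on_extend_finite:
  assumes \<kappa>: "character_on H \<kappa>" and "finite B"
  shows "\<exists>H' \<kappa>'. character_on H' \<kappa>' \<and> H \<subseteq> H' \<and> B \<subseteq> H' \<and> (\<forall>x\<in>H. \<kappa>' x = \<kappa> x)"
  using assms(2)
proof induction
  case empty
  then show ?case using \<kappa> by blast
next
  case (insert g B)
  then obtain H' \<kappa>' where 1: "character_on H' \<kappa>'" "H \<subseteq> H'" "B \<subseteq> H'" "\<forall>x\<in>H. \<kappa>' x = \<kappa> x" by blast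
  obtain H'' \<kappa>''
    where "character_on H'' \<kappa>''" "H' \<subseteq> H''" "g \<in> H''" "\<And>x. x \<in> H' \<Longrightarrow> \<kappa>'' x = \<kappa>' x"
    using character_on_extend_one[OF 1(1), of g] by blast
  with 1 show ?case by (intro exI[of _ H''] exI[of _ \<kappa>'']) auto
qed

lemma character_on_extend:
  assumes \<kappa>: "character_on H \<kappa>"
  obtains \<kappa>' where "character_on UNIV \<kappa>'" "\<And>x. x \<in> H \<Longrightarrow> \<kappa>' x = \<kappa> x"
proof -
  obtain H' \<kappa>' where 1: "character_on H' \<kappa>'" "range (\<lambda>i. axis i 1) \<subseteq> H'" "\<forall>x\<in>H. \<kappa>' x = \<kappa> x"
    using character_on_extend_finite[OF \<kappa>, of "range (\<lambda>i. axis i 1)"] by auto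
  have "x \<in> H'" for x
  proof -
    have "(\<Sum>i\<in>A. x $ i *s axis i 1) \<in> H'" if "finite A" for A
      using that
    proof induction
      case empty
      then show ?case using character_on_zero[OF 1(1)] by simp
    next
      case (insert i A)
      then show ?case
        using character_on_add(1)[OF 1(1)] character_on_scale[OF 1(1)] 1(2) by (simp add: image_subset_iff)
    qed
    then show ?thesis using basis_expansion[of x] by (metis finite)
  qed
  then have "H' = UNIV" by blast
  with 1 that show thesis by blast
qed

section \<open>Complex points of a finitely generated monoid\<close>

text \<open>The generated submonoid, built one generator at a time so that
  \<open>monoid_hull_scaled\<close> can charge one copy of \<open>v\<close> to each
  generator.\<close>

inductive_set monoid_hull :: "'a::comm_monoid_add set \<Rightarrow> 'a set" for D where
  zero: "0 \<in> monoid_hull D"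
| step: "d \<in> D \<Longrightarrow> x \<in> monoid_hull D \<Longrightarrow> d + x \<in> monoid_hull D"

lemma monoid_hull_base: "d \<in> D \<Longrightarrow> d \<in> monoid_hull D"
  using monoid_hull.step[OF _ monoid_hull.zero] by force

lemma monoid_hull_add: "x \<in> monoid_hull D \<Longrightarrow> y \<in> monoid_hull D \<Longrightarrow> x + y \<in> monoid_hull D"
  by (induction rule: monoid_hull.induct) (auto simp: add.assoc intro: monoid_hull.step)

text \<open>\<open>\<mu>\<close> records the values of an algebra homomorphism on the monomials with
  exponents in the hull of \<open>D\<close>; it may vanish there.\<close>

locale monoid_point =
  fixes D :: "(int ^ 'n::finite) set" and \<mu> :: "int ^ 'n \<Rightarrow> complex"
  assumes finite_D: "finite D"
    and \<mu>_zero: "\<mu> 0 = 1"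
    and \<mu>_add: "\<And>x y. x \<in> monoid_hull D \<Longrightarrow> y \<in> monoid_hull D \<Longrightarrow> \<mu> (x + y) = \<mu> x * \<mu> y"
begin

lemma \<mu>_scale:
  assumes "x \<in> monoid_hull D"
  shows "int k *s x \<in> monoid_hull D \<and> \<mu> (int k *s x) = \<mu> x ^ k"
proof (induction k)
  case 0
  then show ?case by (simp add: \<mu>_zero monoid_hull.zero)
next
  case (Suc k)
  have "int (Suc k) *s x = x + int k *s x" by (simp add: vector_sadd_rdistrib)
  then show ?case using Suc assms monoid_hull_add[of x D "int k *s x"] \<mu>_add[of x "int k *s x"] by simp
qed

lemma \<mu>_sum:
  assumes "finite A" "A \<subseteq> D"
  shows "(\<Sum>d\<in>A. int (k d) *s d) \<in> monoid_hull D \<and> \<mu> (\<Sum>d\<in>A. int (k d) *s d) = (\<Prod>d\<in>A. \<mu> d ^ k d)"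
  using assms
proof (induction A rule: finite_induct)
  case empty
  then show ?case by (simp add: \<mu>_zero monoid_hull.zero)
next
  case (insert d A)
  then show ?case using \<mu>_scale[of d "k d"] monoid_hull_base[of d D]
    by (simp add: monoid_hull_add \<mu>_add)
qed

text \<open>
  Farkas' lemma: a nonnegative combination of \<open>D\<close> that equals a combination of exponents with
  nonvanishing \<open>\<mu>\<close> cannot involve an exponent with vanishing \<open>\<mu>\<close>.
\<close>

lemma separating_functional:
  assumes d0: "d0 \<in> D" "\<mu> d0 = 0"
  shows "\<exists>u. (\<forall>d\<in>D. 0 \<le> u \<bullet> real_vec d) \<and> (\<forall>d\<in>D. \<mu> d \<noteq> 0 \<longrightarrow> u \<bullet> real_vec d = 0) \<and>
    0 < u \<bullet> real_vec d0"
proof -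
  define J where "J = {d \<in> D. \<mu> d \<noteq> 0}"
  \<comment> \<open>Exponents with nonvanishing \<open>\<mu>\<close> enter with both signs, so a
    functional that is nonnegative on \<open>C\<close> vanishes on them.\<close>
  define C where "C = convex_cone hull (real_vec ` D \<union> (\<lambda>d. - real_vec d) ` J)"
  define K where "K = {(\<Sum>d\<in>D. c d *\<^sub>R real_vec d) | c. \<forall>d\<in>D - J. 0 \<le> c d}"
  have single: "(\<Sum>d\<in>D. (if d = e then t else 0) *\<^sub>R real_vec d) = t *\<^sub>R real_vec e" if "e \<in> D" for e t
    using that finite_D by (simp add: if_distrib[of "\<lambda>c. c *\<^sub>R _"] cong: if_cong)
  have "C \<subseteq> K"
    unfolding C_def
  proof (rule hull_minimal)
    have "real_vec d \<in> K" if "d \<in> D" for d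
      using single[OF that, of 1] unfolding K_def
      by (auto intro!: exI[of _ "\<lambda>e. if e = d then 1 else 0"])
    moreover have "- real_vec d \<in> K" if "d \<in> J" for d
      using single[of d "-1"] that unfolding K_def
      by (auto intro!: exI[of _ "\<lambda>e. if e = d then -1 else 0"] simp: J_def split: if_splits)
    ultimately show "real_vec ` D \<union> (\<lambda>d. - real_vec d) ` J \<subseteq> K" by auto
    have "x + y \<in> K" if xy: "x \<in> K" "y \<in> K" for x y
    proof -
      obtain a b where ab: "\<forall>d\<in>D - J. 0 \<le> a d" "\<forall>d\<in>D - J. 0 \<le> b d"
        "x = (\<Sum>d\<in>D. a d *\<^sub>R real_vec d)" "y = (\<Sum>d\<in>D. b d *\<^sub>R real_vec d)"
        using xy unfolding K_def by blast
      then have "x + y = (\<Sum>d\<in>D. (a d + b d) *\<^sub>R real_vec d)"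
        by (simp add: scaleR_left_distrib sum.distrib)
      with ab show ?thesis unfolding K_def by (auto intro!: exI[of _ "\<lambda>d. a d + b d"])
    qed
    moreover have "t *\<^sub>R x \<in> K" if x: "x \<in> K" and "0 \<le> t" for x t
    proof -
      obtain a where a: "\<forall>d\<in>D - J. 0 \<le> a d" "x = (\<Sum>d\<in>D. a d *\<^sub>R real_vec d)"
        using x unfolding K_def by blast
      then have "t *\<^sub>R x = (\<Sum>d\<in>D. (t * a d) *\<^sub>R real_vec d)"
        by (simp add: scaleR_right.sum)
      with a \<open>0 \<le> t\<close> show ?thesis unfolding K_def by (auto intro!: exI[of _ "\<lambda>d. t * a d"])
    qed
    moreover have "0 \<in> K" unfolding K_def by (auto intro!: exI[of _ "\<lambda>d. 0"])
    ultimately show "convex_cone K" 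
      unfolding convex_cone_iff by (intro conjI ballI allI impI) simp_all
  qed
  have "- real_vec d0 \<notin> C"
  proof
    assume "- real_vec d0 \<in> C"
    with \<open>C \<subseteq> K\<close> obtain c where c: "\<forall>d\<in>D - J. 0 \<le> c d"
      "- real_vec d0 = (\<Sum>d\<in>D. c d *\<^sub>R real_vec d)" unfolding K_def by blast
    \<comment> \<open>Moving \<open>d0\<close> to the other side makes its coefficient positive, and
      \<open>integral_relation\<close> preserves this sign.\<close>
    define c' where "c' d = c d + (if d = d0 then 1 else 0)" for d
    have "(\<Sum>d\<in>D. c' d *\<^sub>R real_vec d) = 0"
      using single[OF d0(1), of 1] by (simp add: c'_def scaleR_left_distrib sum.distrib flip: c(2))
    then obtain p where p: "(\<Sum>d\<in>D. p d *s d) = 0"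
      "\<And>d. d \<in> D \<Longrightarrow> 0 \<le> c' d \<Longrightarrow> 0 \<le> p d" "\<And>d. d \<in> D \<Longrightarrow> 0 < c' d \<Longrightarrow> 0 < p d"
      using integral_relation[OF finite_D] by blast
    \<comment> \<open>Separating positive and negative coefficients gives two equal monoid elements.
      Applying \<open>\<mu>\<close> gives \<open>0\<close> on the side containing \<open>d0\<close>,
      but a nonzero value on the other side, which involves only exponents in
      \<open>J\<close>.\<close>
    have "p d *s d = int (nat (p d)) *s d - int (nat (- p d)) *s d" for d
      by (cases "0 \<le> p d") (simp_all add: vector_sneg_minus1)
    then have "(\<Sum>d\<in>D. int (nat (p d)) *s d) = (\<Sum>d\<in>D. int (nat (- p d)) *s d)"
      using p(1) by (simp add: sum_subtractf)
    then have "(\<Prod>d\<in>D. \<mu> d ^ nat (p d)) = (\<Prod>d\<in>D. \<mu> d ^ nat (- p d))"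
      using \<mu>_sum[OF finite_D order_refl, of "\<lambda>d. nat (p d)"]
        \<mu>_sum[OF finite_D order_refl, of "\<lambda>d. nat (- p d)"] by simp
    moreover have "(\<Prod>d\<in>D. \<mu> d ^ nat (p d)) = 0"
    proof -
      have "d0 \<in> D - J" using d0 by (simp add: J_def)
      then have "0 < c' d0" using c(1) by (auto simp: c'_def intro: add_nonneg_pos)
      then have "0 < p d0" using p(3) d0 by blast
      then show ?thesis using d0 finite_D by (auto simp: prod_zero_iff)
    qed
    moreover have "(\<Prod>d\<in>D. \<mu> d ^ nat (- p d)) \<noteq> 0"
    proof -
      have "\<mu> d ^ nat (- p d) \<noteq> 0" if "d \<in> D" for d
      proof (cases "d \<in> J")
        case False
        then have "0 \<le> p d" using that c(1) p(2)[OF that] by (auto simp: c'_def)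
        then show ?thesis by simp
      qed (simp add: J_def)
      then show ?thesis using finite_D by (simp add: prod_zero_iff)
    qed
    ultimately show False by simp
  qed
  moreover have "closed C" "convex C"
    unfolding C_def J_def using finite_D by (auto intro: closed_convex_cone_hull convex_convex_cone_hull)
  ultimately obtain u b where u: "u \<bullet> (- real_vec d0) < b" "\<And>x. x \<in> C \<Longrightarrow> b < u \<bullet> x"
    using separating_hyperplane_closed_point[of C "- real_vec d0"] by blast
  have b0: "b < 0" using u(2)[of 0] by (simp add: C_def convex_cone_hull_contains_0)
  have nonneg: "0 \<le> u \<bullet> x" if "x \<in> C" for x
  proof (rule ccontr)
    assume *: "\<not> ?thesis"
    \<comment> \<open>On this multiple \<open>u\<close> takes the value \<open>b\<close> itself,
      against the strict bound on the cone.\<close>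
    then have "(b / (u \<bullet> x)) *\<^sub>R x \<in> C"
      using that b0 unfolding C_def by (intro convex_cone_hull_mul) (auto simp: divide_nonpos_neg)
    from u(2)[OF this] show False using * by simp
  qed
  have DC: "real_vec d \<in> C" if "d \<in> D" for d
    using that unfolding C_def by (intro hull_inc) auto
  have JC: "- real_vec d \<in> C" if "d \<in> J" for d
    using that unfolding C_def by (intro hull_inc) auto
  have "u \<bullet> real_vec d = 0" if "d \<in> D" "\<mu> d \<noteq> 0" for d
    using nonneg[OF DC, of d] nonneg[OF JC, of d] that by (simp add: J_def)
  moreover have "0 < u \<bullet> real_vec d0" using u(1) b0 by simp
  ultimately show ?thesis using nonneg[OF DC] by blast
qed

text \<open>Each separating functional vanishes wherever \<open>\<mu>\<close> does not and is
  positive at its own generator. Their sum is therefore positive at exactly the generators with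
  vanishing \<open>\<mu>\<close>, and additivity carries this to the hull.\<close>

lemma face_functional:
  obtains u where "\<And>d. d \<in> D \<Longrightarrow> 0 \<le> u \<bullet> real_vec d"
    and "\<And>x. x \<in> monoid_hull D \<Longrightarrow> u \<bullet> real_vec x = 0 \<longleftrightarrow> \<mu> x \<noteq> 0"
proof -
  obtain w where w: "\<And>d0 d. d0 \<in> D \<Longrightarrow> \<mu> d0 = 0 \<Longrightarrow> d \<in> D \<Longrightarrow> 0 \<le> w d0 \<bullet> real_vec d"
    "\<And>d0 d. d0 \<in> D \<Longrightarrow> \<mu> d0 = 0 \<Longrightarrow> d \<in> D \<Longrightarrow> \<mu> d \<noteq> 0 \<Longrightarrow> w d0 \<bullet> real_vec d = 0"
    "\<And>d0. d0 \<in> D \<Longrightarrow> \<mu> d0 = 0 \<Longrightarrow> 0 < w d0 \<bullet> real_vec d0"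
    using separating_functional by metis
  define Z where "Z = {d \<in> D. \<mu> d = 0}"
  define u where "u = (\<Sum>d\<in>Z. w d)"
  have Z: "finite Z" using finite_D by (simp add: Z_def)
  have u0: "0 \<le> u \<bullet> real_vec d" if "d \<in> D" for d
    unfolding u_def inner_sum_left using w(1) that by (intro sum_nonneg) (auto simp: Z_def)
  have uD: "u \<bullet> real_vec d = 0 \<longleftrightarrow> \<mu> d \<noteq> 0" if d: "d \<in> D" for d
  proof (cases "\<mu> d = 0")
    case True
    then have "0 < w d \<bullet> real_vec d" "d \<in> Z" using w(3) d by (auto simp: Z_def)
    moreover have "w d \<bullet> real_vec d \<le> u \<bullet> real_vec d"
      unfolding u_def inner_sum_left using w(1) d Z \<open>d \<in> Z\<close>
      by (intro member_le_sum) (auto simp: Z_def)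
    ultimately show ?thesis using True by simp
  next
    case False
    then show ?thesis unfolding u_def inner_sum_left using w(2) d
      by (auto simp: Z_def intro!: sum.neutral)
  qed
  have "0 \<le> u \<bullet> real_vec x \<and> (u \<bullet> real_vec x = 0 \<longleftrightarrow> \<mu> x \<noteq> 0)" if "x \<in> monoid_hull D" for x
    using that
  proof induction
    case zero
    then show ?case by (simp add: \<mu>_zero)
  next
    case (step d x)
    then show ?case
      using u0[of d] uD[of d] \<mu>_add[OF monoid_hull_base[of d D], of x]
      by (auto simp: real_vec_add inner_add_right add_nonneg_eq_0_iff)
  qed
  with u0 that show thesis by blast
qed

text \<open>The exponents with nonvanishing \<open>\<mu>\<close> form a monoid, and quotients extend
  \<open>\<mu>\<close> to its group of differences. They are well defined because
  \<open>x - y = a - b\<close> gives \<open>\<mu> x * \<mu> b = \<mu> a * \<mu> y\<close>.\<close>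

lemma character_on_support:
  obtains H \<kappa> where "character_on H \<kappa>"
    "\<And>x. x \<in> monoid_hull D \<Longrightarrow> \<mu> x \<noteq> 0 \<Longrightarrow> x \<in> H \<and> \<kappa> x = \<mu> x"
proof -
  define S where "S = {x \<in> monoid_hull D. \<mu> x \<noteq> 0}"
  define H where "H = {x - y | x y. x \<in> S \<and> y \<in> S}"
  define \<kappa> where "\<kappa> z = (SOME c. \<exists>x\<in>S. \<exists>y\<in>S. z = x - y \<and> c = \<mu> x / \<mu> y)" for z
  have S0: "0 \<in> S" by (simp add: S_def monoid_hull.zero \<mu>_zero)
  have Sadd: "x + y \<in> S \<and> \<mu> (x + y) = \<mu> x * \<mu> y" if "x \<in> S" "y \<in> S" for x y
    using that by (simp add: S_def monoid_hull_add \<mu>_add)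
  have Snz: "\<mu> x \<noteq> 0" if "x \<in> S" for x using that by (simp add: S_def)
  have \<kappa>: "\<kappa> (x - y) = \<mu> x / \<mu> y" if xy: "x \<in> S" "y \<in> S" for x y
    unfolding \<kappa>_def
  proof (rule some_equality)
    show "\<exists>a\<in>S. \<exists>b\<in>S. x - y = a - b \<and> \<mu> x / \<mu> y = \<mu> a / \<mu> b" using xy by blast
    fix c assume "\<exists>a\<in>S. \<exists>b\<in>S. x - y = a - b \<and> c = \<mu> a / \<mu> b"
    then obtain a b where ab: "a \<in> S" "b \<in> S" "x - y = a - b" "c = \<mu> a / \<mu> b" by blast
    then have "x + b = a + y" by (simp add: algebra_simps)
    then have "\<mu> x * \<mu> b = \<mu> a * \<mu> y" using Sadd xy ab by metis
    then show "c = \<mu> x / \<mu> y" using Snz[OF ab(2)] Snz[OF xy(2)] by (simp add: ab(4) frac_eq_eq)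
  qed
  show thesis
  proof (rule that)
    show "character_on H \<kappa>" unfolding character_on_def
    proof (intro conjI ballI)
      show "0 \<in> H" unfolding H_def using S0 by force
      fix z assume "z \<in> H"
      then obtain x y where xy: "x \<in> S" "y \<in> S" "z = x - y" by (auto simp: H_def)
      then show "\<kappa> z \<noteq> 0" using \<kappa> Snz by simp
      fix w assume "w \<in> H"
      then obtain a b where ab: "a \<in> S" "b \<in> S" "w = a - b" by (auto simp: H_def)
      have eq: "z - w = (x + b) - (y + a)" using xy ab by (simp add: algebra_simps)
      then show "z - w \<in> H" unfolding H_def using Sadd xy ab by blast
      have "\<kappa> (z - w) = \<mu> (x + b) / \<mu> (y + a)" unfolding eq using \<kappa> Sadd xy ab by blast
      then show "\<kappa> (z - w) = \<kappa> z / \<kappa> w" using Sadd xy ab \<kappa> Snz by simp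
    qed
    fix x assume "x \<in> monoid_hull D" "\<mu> x \<noteq> 0"
    then have "x \<in> S" by (simp add: S_def)
    then show "x \<in> H \<and> \<kappa> x = \<mu> x" using \<kappa>[of x 0] S0 \<mu>_zero unfolding H_def by force
  qed
qed

text \<open>\<open>u\<close> names the face and \<open>\<kappa>\<close> the position in its torus
  orbit. Having \<open>\<kappa>\<close> on the whole lattice is what allows the point to be moved to
  another chart.\<close>

lemma face_character:
  obtains u \<kappa> where "\<And>d. d \<in> D \<Longrightarrow> 0 \<le> u \<bullet> real_vec d"
    and "character_on UNIV \<kappa>"
    and "\<And>x. x \<in> monoid_hull D \<Longrightarrow> \<mu> x = (if u \<bullet> real_vec x = 0 then \<kappa> x else 0)"
proof -
  obtain u where u: "\<And>d. d \<in> D \<Longrightarrow> 0 \<le> u \<bullet> real_vec d"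
    "\<And>x. x \<in> monoid_hull D \<Longrightarrow> u \<bullet> real_vec x = 0 \<longleftrightarrow> \<mu> x \<noteq> 0"
    using face_functional by blast
  obtain H \<kappa>\<^sub>0 where H: "character_on H \<kappa>\<^sub>0"
    "\<And>x. x \<in> monoid_hull D \<Longrightarrow> \<mu> x \<noteq> 0 \<Longrightarrow> x \<in> H \<and> \<kappa>\<^sub>0 x = \<mu> x"
    using character_on_support by blast
  obtain \<kappa> where \<kappa>: "character_on UNIV \<kappa>" "\<And>x. x \<in> H \<Longrightarrow> \<kappa> x = \<kappa>\<^sub>0 x"
    using character_on_extend[OF H(1)] by blast
  show thesis
  proof (rule that[OF u(1) \<kappa>(1)])
    fix x assume "x \<in> monoid_hull D"
    then show "\<mu> x = (if u \<bullet> real_vec x = 0 then \<kappa> x else 0)"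
      using u(2)[of x] H(2)[of x] \<kappa>(2)[of x] by auto
  qed
qed

end

section \<open>Common zeros at infinity\<close>

lemma mult_sum_singles:
  fixes f g :: "'a::comm_monoid_add \<Rightarrow>\<^sub>0 'b::comm_ring_1"
  shows "f * g = (\<Sum>a\<in>Poly_Mapping.keys f. \<Sum>b\<in>Poly_Mapping.keys g.
    Poly_Mapping.single (a + b) (Poly_Mapping.lookup f a * Poly_Mapping.lookup g b))"
proof -
  have "f * g = (\<Sum>a\<in>Poly_Mapping.keys f. Poly_Mapping.single a (Poly_Mapping.lookup f a)) *
      (\<Sum>b\<in>Poly_Mapping.keys g. Poly_Mapping.single b (Poly_Mapping.lookup g b))"
    by (simp flip: poly_mapping_sum_singles)
  then show ?thesis by (simp add: sum_product mult_single)
qed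

text \<open>The linear extension of \<open>g\<close> from exponents to the algebra.\<close>

definition eval_exp :: "('a \<Rightarrow> 'b) \<Rightarrow> ('a::comm_monoid_add \<Rightarrow>\<^sub>0 'b::comm_ring_1) \<Rightarrow> 'b" where
  "eval_exp g f = (\<Sum>a\<in>Poly_Mapping.keys f. Poly_Mapping.lookup f a * g a)"

lemma eval_exp_superset:
  assumes "finite A" "Poly_Mapping.keys f \<subseteq> A"
  shows "eval_exp g f = (\<Sum>a\<in>A. Poly_Mapping.lookup f a * g a)"
  unfolding eval_exp_def using assms by (intro sum.mono_neutral_left) (auto simp: in_keys_iff)

lemma eval_exp_add: "eval_exp g (f + h) = eval_exp g f + eval_exp g h"
proof -
  let ?A = "Poly_Mapping.keys f \<union> Poly_Mapping.keys h"
  have "eval_exp g k = (\<Sum>a\<in>?A. Poly_Mapping.lookup k a * g a)"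
    if "k \<in> {f, h, f + h}" for k
    using that Poly_Mapping.keys_add[of f h] by (intro eval_exp_superset) auto
  then show ?thesis by (simp add: lookup_add distrib_right sum.distrib)
qed

lemma eval_exp_zero [simp]: "eval_exp g 0 = 0"
  by (simp add: eval_exp_def)

lemma eval_exp_single [simp]: "eval_exp g (Poly_Mapping.single a c) = c * g a"
  by (subst eval_exp_superset[of "{a}"]) auto

lemma eval_exp_sum: "eval_exp g (sum f A) = (\<Sum>i\<in>A. eval_exp g (f i))"
  by (induction A rule: infinite_finite_induct) (simp_all add: eval_exp_add)

lemma eval_exp_mult_expand:
  "eval_exp g (f * h) = (\<Sum>a\<in>Poly_Mapping.keys f. \<Sum>b\<in>Poly_Mapping.keys h.
    Poly_Mapping.lookup f a * Poly_Mapping.lookup h b * g (a + b))"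
  unfolding mult_sum_singles[of f h] eval_exp_sum by simp

lemma eval_exp_mult:
  assumes "\<And>a b. a \<in> Poly_Mapping.keys f \<Longrightarrow> b \<in> Poly_Mapping.keys h \<Longrightarrow> g (a + b) = g a * g b"
  shows "eval_exp g (f * h) = eval_exp g f * eval_exp g h"
  unfolding eval_exp_mult_expand
  by (simp add: eval_exp_def sum_product assms ac_simps)

lemma eval_exp_single_mult:
  "eval_exp g (Poly_Mapping.single w 1 * f) =
    (\<Sum>a\<in>Poly_Mapping.keys f. Poly_Mapping.lookup f a * g (w + a))"
  unfolding eval_exp_mult_expand by simp

lemma algebra_hom_eq_eval_exp:
  fixes \<phi> :: "('a::comm_monoid_add \<Rightarrow>\<^sub>0 'b::comm_ring_1) \<Rightarrow> 'b"
  assumes "0 \<in> M"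
    and const: "\<And>c. \<phi> (const c) = c"
    and add: "\<And>f g. f \<in> supported_on M \<Longrightarrow> g \<in> supported_on M \<Longrightarrow> \<phi> (f + g) = \<phi> f + \<phi> g"
    and mult: "\<And>f g. f \<in> supported_on M \<Longrightarrow> g \<in> supported_on M \<Longrightarrow> \<phi> (f * g) = \<phi> f * \<phi> g"
    and f: "f \<in> supported_on M"
  shows "\<phi> f = eval_exp (\<lambda>a. \<phi> (Poly_Mapping.single a 1)) f"
proof -
  have single: "\<phi> (Poly_Mapping.single a c) = c * \<phi> (Poly_Mapping.single a 1)" if "a \<in> M" for a c
    using mult[of "const c" "Poly_Mapping.single a 1"] that \<open>0 \<in> M\<close> const
    by (simp add: supported_on_single mult_single)
  have "\<phi> (\<Sum>a\<in>A. Poly_Mapping.single a (k a)) = (\<Sum>a\<in>A. k a * \<phi> (Poly_Mapping.single a 1))"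
    if "finite A" "A \<subseteq> M" for A k
    using that
  proof (induction A)
    case empty
    then show ?case using const[of 0] by simp
  next
    case (insert a A)
    then have "Poly_Mapping.single a (k a) \<in> supported_on M"
      "(\<Sum>a\<in>A. Poly_Mapping.single a (k a)) \<in> supported_on M"
      by (auto intro!: supported_on_single supported_on_sum)
    from add[OF this] insert single[of a "k a"] show ?case by simp
  qed
  from this[of "Poly_Mapping.keys f" "Poly_Mapping.lookup f"] f show ?thesis
    unfolding eval_exp_def supported_on_def by (simp flip: poly_mapping_sum_singles)
qed

section \<open>Polynomials among Laurent polynomials\<close>

lemma inj_int_exp: "inj int_exp"
  by (auto simp: inj_def int_exp_def vec_eq_iff)

lemma int_exp_add: "int_exp (a + b) = int_exp a + int_exp b"
  by (simp add: int_exp_def vec_eq_iff)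

lemma lookup_laurent_of: "Poly_Mapping.lookup (laurent_of F) (int_exp a) = Poly_Mapping.lookup F a"
  by (simp add: laurent_of_def lookup_sum lookup_single when_def in_keys_iff inj_eq[OF inj_int_exp])

lemma keys_laurent_of: "Poly_Mapping.keys (laurent_of F) = int_exp ` Poly_Mapping.keys F"
proof
  show "Poly_Mapping.keys (laurent_of F) \<subseteq> int_exp ` Poly_Mapping.keys F"
    using supported_on_sum[of "Poly_Mapping.keys F"
        "\<lambda>a. Poly_Mapping.single (int_exp a) (Poly_Mapping.lookup F a)"]
    by (simp add: laurent_of_def supported_on_def)
  show "int_exp ` Poly_Mapping.keys F \<subseteq> Poly_Mapping.keys (laurent_of F)"
    by (auto simp: in_keys_iff lookup_laurent_of)
qed

lemma lookup_laurent_of_notin: "b \<notin> range int_exp \<Longrightarrow> Poly_Mapping.lookup (laurent_of F) b = 0"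
  by (rule ccontr) (auto simp: keys_laurent_of simp flip: in_keys_iff)

lemma laurent_of_eqI:
  assumes "\<And>a. Poly_Mapping.lookup f (int_exp a) = Poly_Mapping.lookup F a"
    and "\<And>b. b \<notin> range int_exp \<Longrightarrow> Poly_Mapping.lookup f b = 0"
  shows "laurent_of F = f"
proof (rule poly_mapping_eqI)
  fix b
  show "Poly_Mapping.lookup (laurent_of F) b = Poly_Mapping.lookup f b"
    using assms lookup_laurent_of lookup_laurent_of_notin by (cases "b \<in> range int_exp") auto
qed

lemma laurent_of_add: "laurent_of (F + G) = laurent_of F + laurent_of G"
  by (rule laurent_of_eqI) (simp_all add: lookup_add lookup_laurent_of lookup_laurent_of_notin)

lemma laurent_of_zero [simp]: "laurent_of 0 = 0"
  by (simp add: laurent_of_def)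

lemma laurent_of_sum: "laurent_of (sum F A) = (\<Sum>i\<in>A. laurent_of (F i))"
  by (induction A rule: infinite_finite_induct) (simp_all add: laurent_of_add)

lemma laurent_of_single: "laurent_of (Poly_Mapping.single a c) = Poly_Mapping.single (int_exp a) c"
  by (simp add: laurent_of_def)

lemma laurent_of_mult: "laurent_of (F * G) = laurent_of F * laurent_of G"
proof -
  have "laurent_of (F * G) =
    (\<Sum>a\<in>Poly_Mapping.keys F. \<Sum>b\<in>Poly_Mapping.keys G. Poly_Mapping.single (int_exp a + int_exp b)
        (Poly_Mapping.lookup F a * Poly_Mapping.lookup G b))"
    unfolding mult_sum_singles[of F G] by (simp add: laurent_of_sum laurent_of_single int_exp_add)
  also have "\<dots> = laurent_of F * laurent_of G"
    by (simp add: laurent_of_def sum_product mult_single)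
  finally show ?thesis .
qed

lemma inj_laurent_of: "inj laurent_of"
  by (metis injI lookup_laurent_of poly_mapping_eqI)

lemma laurent_of_surj:
  assumes "Poly_Mapping.keys f \<subseteq> range int_exp"
  obtains F where "laurent_of F = f"
proof -
  have "laurent_of (\<Sum>b\<in>Poly_Mapping.keys f.
      Poly_Mapping.single (inv int_exp b) (Poly_Mapping.lookup f b)) =
    (\<Sum>b\<in>Poly_Mapping.keys f. Poly_Mapping.single b (Poly_Mapping.lookup f b))"
    using assms by (simp add: laurent_of_sum laurent_of_single f_inv_into_f subset_iff)
  with that show thesis by (simp flip: poly_mapping_sum_singles)
qed

lemma supp_eq_real_vec_keys: "supp F = real_vec ` Poly_Mapping.keys (laurent_of F)"
  by (simp add: supp_def keys_laurent_of image_image)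

section \<open>Charts and points on torus orbits\<close>

lemma coord_ring_eq_supported_on: "coord_ring \<sigma> = supported_on {a. real_vec a \<in> dual_cone \<sigma>}"
  by (auto simp: coord_ring_def supported_on_def)

lemma coord_ring_nonneg:
  "f \<in> coord_ring \<sigma> \<Longrightarrow> a \<in> Poly_Mapping.keys f \<Longrightarrow> u \<in> \<sigma> \<Longrightarrow> 0 \<le> u \<bullet> real_vec a"
  by (simp add: coord_ring_def dual_cone_def)

lemma chart_mult:
  "\<psi> \<in> chart \<sigma> \<Longrightarrow> f \<in> coord_ring \<sigma> \<Longrightarrow> g \<in> coord_ring \<sigma> \<Longrightarrow> \<psi> (f * g) = \<psi> f * \<psi> g"
  by (simp add: chart_def)

lemma chart_const: "\<psi> \<in> chart \<sigma> \<Longrightarrow> \<psi> (const c) = c"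
  by (simp add: chart_def)

lemma glue_refl:
  assumes "\<sigma> \<in> \<Delta>" "\<psi> \<in> chart \<sigma>"
  shows "((\<sigma>, \<psi>), (\<sigma>, \<psi>)) \<in> glue \<Delta>"
proof -
  have "restrict \<psi> (coord_ring \<sigma>) = \<psi>"
    using assms by (simp add: chart_def extensional_restrict)
  then show ?thesis
    unfolding glue_def mem_Collect_eq using assms
    by (intro exI[of _ \<sigma>] exI[of _ \<psi>]) simp
qed

text \<open>The point with torus coordinates \<open>\<kappa>\<close> on the orbit of the face where
  \<open>u\<close> vanishes; monomials off that face are sent to \<open>0\<close>. Restriction is
  required because points of charts are extensional.\<close>

definition face_point ::
    "(real ^ 'n::finite) set \<Rightarrow> real ^ 'n \<Rightarrow> (int ^ 'n \<Rightarrow> complex) \<Rightarrow> 'n laurent \<Rightarrow> complex" where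
  "face_point \<sigma> u \<kappa> = restrict (eval_exp (\<lambda>a. if u \<bullet> real_vec a = 0 then \<kappa> a else 0)) (coord_ring \<sigma>)"

text \<open>As \<open>u\<close> is nonnegative on all exponents of the ring, it vanishes on a sum
  only if it vanishes on both summands. This makes the cutoff multiplicative.\<close>

lemma face_point_chart:
  assumes u: "u \<in> \<sigma>" and \<kappa>: "character_on UNIV \<kappa>"
  shows "face_point \<sigma> u \<kappa> \<in> chart \<sigma>"
proof -
  let ?g = "\<lambda>a. if u \<bullet> real_vec a = 0 then \<kappa> a else 0"
  have const: "const c \<in> coord_ring \<sigma>" for c
    by (simp add: coord_ring_def dual_cone_def)
  have add: "f + g \<in> coord_ring \<sigma>" if "f \<in> coord_ring \<sigma>" "g \<in> coord_ring \<sigma>" for f g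
    using that unfolding coord_ring_eq_supported_on by (rule supported_on_add)
  have mult: "f * g \<in> coord_ring \<sigma>" if "f \<in> coord_ring \<sigma>" "g \<in> coord_ring \<sigma>" for f g
    using that unfolding coord_ring_eq_supported_on
    by (rule supported_on_mult) (auto simp: dual_cone_def real_vec_add inner_add_right)
  have eval_mult: "eval_exp ?g (f * g) = eval_exp ?g f * eval_exp ?g g"
    if fg: "f \<in> coord_ring \<sigma>" "g \<in> coord_ring \<sigma>" for f g
  proof (rule eval_exp_mult)
    fix a b assume ab: "a \<in> Poly_Mapping.keys f" "b \<in> Poly_Mapping.keys g"
    have "0 \<le> u \<bullet> real_vec a" "0 \<le> u \<bullet> real_vec b"
      using coord_ring_nonneg[OF fg(1) ab(1) u] coord_ring_nonneg[OF fg(2) ab(2) u] .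
    then show "?g (a + b) = ?g a * ?g b"
      using character_on_add[OF \<kappa>, of a b] by (simp add: real_vec_add inner_add_right add_nonneg_eq_0_iff)
  qed
  have val: "face_point \<sigma> u \<kappa> f = eval_exp ?g f" if "f \<in> coord_ring \<sigma>" for f
    using that by (simp add: face_point_def)
  show ?thesis
    unfolding chart_def mem_Collect_eq
  proof (intro conjI allI ballI)
    show "face_point \<sigma> u \<kappa> \<in> extensional (coord_ring \<sigma>)" by (simp add: face_point_def)
    show "face_point \<sigma> u \<kappa> (const c) = c" for c
      unfolding val[OF const] eval_exp_single using character_on_zero(2)[OF \<kappa>] by simp
    fix f g assume fg: "f \<in> coord_ring \<sigma>" "g \<in> coord_ring \<sigma>"
    show "face_point \<sigma> u \<kappa> (f + g) = face_point \<sigma> u \<kappa> f + face_point \<sigma> u \<kappa> g"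
      unfolding val[OF add[OF fg]] val[OF fg(1)] val[OF fg(2)] by (rule eval_exp_add)
    show "face_point \<sigma> u \<kappa> (f * g) = face_point \<sigma> u \<kappa> f * face_point \<sigma> u \<kappa> g"
      unfolding val[OF mult[OF fg]] val[OF fg(1)] val[OF fg(2)] by (rule eval_mult[OF fg])
  qed
qed

text \<open>
  If \<open>1\<close> is not in the ideal of the sections at the point \<open>v\<close>, the Nullstellensatz gives a common
  zero at infinity on the affine chart of \<open>v\<close>. It lies on the torus orbit of a face, and inserting the
  extended character of that orbit into a cone of \<open>\<Delta>\<close> that contains the functional \<open>u\<close> lifts
  it to the toric variety of \<open>\<Delta>\<close>.
\<close>

lemma local_sections_generate:
  fixes F :: "nat \<Rightarrow> 'n::finite cpoly"
  assumes P: "P \<subseteq> first_orthant" "0 \<in> P" "finite {y. real_vec y \<in> P}"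
    and supp: "\<And>j. j \<in> {1..m} \<Longrightarrow> supp (F j) \<subseteq> P"
    and no_zeros: "no_common_zeros_at_infinity P m F"
    and v: "real_vec v \<in> P"
  defines "M \<equiv> monoid_hull ((\<lambda>y. y - v) ` {y. real_vec y \<in> P})"
  shows "\<exists>a b. (\<forall>j\<in>{1..m}. a j \<in> supported_on M) \<and> b \<in> supported_on M \<and>
    1 = (\<Sum>j = 1..m. local_section v (F j) * a j) + Poly_Mapping.single (- v) 1 * b"
proof (rule ccontr)
  define D where "D = (\<lambda>y. y - v) ` {y. real_vec y \<in> P}"
  define s where "s j = local_section v (F j)" for j
  \<comment> \<open>The section of the constant \<open>1\<close> in the trivialization at
    \<open>v\<close>. Its vanishing is what will place the common zero at infinity.\<close>
  define t where "t = Poly_Mapping.single (- v) (1::complex)"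
  define I where "I = {(\<Sum>j = 1..m. s j * a j) + t * b | a b. (\<forall>j\<in>{1..m}. a j \<in> supported_on M) \<and> b \<in> supported_on M}"
  assume "\<not> (\<exists>a b. (\<forall>j\<in>{1..m}. a j \<in> supported_on M) \<and> b \<in> supported_on M \<and>
    1 = (\<Sum>j = 1..m. local_section v (F j) * a j) + Poly_Mapping.single (- v) 1 * b)"
  then have "1 \<notin> I" unfolding I_def s_def t_def by blast
  have M: "M = monoid_hull D" by (simp add: M_def D_def)
  have "- v \<in> D" unfolding D_def using P(2) by (intro image_eqI[of _ _ 0]) auto
  then have t_M: "t \<in> supported_on M"
    unfolding t_def M by (intro supported_on_single monoid_hull_base)
  have key_P: "real_vec a \<in> P" if "j \<in> {1..m}" "a \<in> Poly_Mapping.keys (laurent_of (F j))" for a j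
    using supp[OF that(1)] that(2) by (auto simp: supp_eq_real_vec_keys)
  have s_M: "s j \<in> supported_on M" if "j \<in> {1..m}" for j
  proof -
    have "laurent_of (F j) \<in> supported_on {y. real_vec y \<in> P}"
      using key_P[OF that] by (auto simp: supported_on_def)
    with supported_on_single[of "- v" "{- v}"] show ?thesis
      unfolding s_def local_section_def M
      by (rule supported_on_mult) (auto simp: D_def intro: monoid_hull_base)
  qed
  have I_intro: "(\<Sum>j = 1..m. s j * a j) + t * b \<in> I"
    if "\<forall>j\<in>{1..m}. a j \<in> supported_on M" "b \<in> supported_on M" for a b
    unfolding I_def using that by blast
  have I_elim: "\<exists>a b. f = (\<Sum>j = 1..m. s j * a j) + t * b \<and>
      (\<forall>j\<in>{1..m}. a j \<in> supported_on M) \<and> b \<in> supported_on M" if "f \<in> I" for f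
    using that unfolding I_def by blast
  interpret ideal: monoid_algebra_ideal M I
  proof
    show "0 \<in> M" unfolding M by (rule monoid_hull.zero)
    show add_M: "a + b \<in> M" if "a \<in> M" "b \<in> M" for a b
      using that unfolding M by (rule monoid_hull_add)
    have mult_M: "f * g \<in> supported_on M" if "f \<in> supported_on M" "g \<in> supported_on M" for f g :: "'n laurent"
      using that add_M by (rule supported_on_mult)
    show "I \<subseteq> supported_on M"
    proof
      fix f assume "f \<in> I"
      then obtain a b where "f = (\<Sum>j = 1..m. s j * a j) + t * b"
        "\<forall>j\<in>{1..m}. a j \<in> supported_on M" "b \<in> supported_on M" using I_elim by blast
      then show "f \<in> supported_on M"
        using s_M t_M by (auto intro!: supported_on_add supported_on_sum mult_M)
    qed
    show "0 \<in> I"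
      using I_intro[of "\<lambda>j. 0" 0] by (simp add: supported_on_zero)
    show "f + g \<in> I" if fg: "f \<in> I" "g \<in> I" for f g
    proof -
      obtain a b c d where *: "\<forall>j\<in>{1..m}. a j \<in> supported_on M" "b \<in> supported_on M"
        "\<forall>j\<in>{1..m}. c j \<in> supported_on M" "d \<in> supported_on M"
        and fg': "f = (\<Sum>j = 1..m. s j * a j) + t * b" "g = (\<Sum>j = 1..m. s j * c j) + t * d"
        using I_elim[OF fg(1)] I_elim[OF fg(2)] by blast
      have "f + g = (\<Sum>j = 1..m. s j * (a j + c j)) + t * (b + d)"
        by (simp add: fg' distrib_left sum.distrib)
      also have "\<dots> \<in> I" using * by (intro I_intro) (auto intro: supported_on_add)
      finally show ?thesis .
    qed
    show "f * g \<in> I" if fg: "f \<in> I" "g \<in> supported_on M" for f g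
    proof -
      obtain a b where *: "\<forall>j\<in>{1..m}. a j \<in> supported_on M" "b \<in> supported_on M"
        and f: "f = (\<Sum>j = 1..m. s j * a j) + t * b"
        using I_elim[OF fg(1)] by blast
      have "f * g = (\<Sum>j = 1..m. s j * (a j * g)) + t * (b * g)"
        by (simp add: f distrib_right sum_distrib_right mult.assoc)
      also have "\<dots> \<in> I" using * fg(2) by (intro I_intro) (auto intro: mult_M)
      finally show ?thesis .
    qed
  qed (fact \<open>1 \<notin> I\<close>)
  obtain \<phi> where \<phi>: "\<And>c. \<phi> (const c) = c"
    "\<And>f g. f \<in> ideal.R \<Longrightarrow> g \<in> ideal.R \<Longrightarrow> \<phi> (f + g) = \<phi> f + \<phi> g"
    "\<And>f g. f \<in> ideal.R \<Longrightarrow> g \<in> ideal.R \<Longrightarrow> \<phi> (f * g) = \<phi> f * \<phi> g"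
    "\<And>f. f \<in> I \<Longrightarrow> \<phi> f = 0"
    using ideal.algebra_hom_exists by blast
  define \<mu> where "\<mu> x = \<phi> (Poly_Mapping.single x 1)" for x
  have \<phi>_eval: "\<phi> f = eval_exp \<mu> f" if "f \<in> supported_on M" for f
    unfolding \<mu>_def using algebra_hom_eq_eval_exp[OF ideal.zero_M \<phi>(1-3) that] .
  have sI: "s j \<in> I" if "j \<in> {1..m}" for j
  proof -
    have "s j = (\<Sum>i = 1..m. s i * (if i = j then 1 else 0)) + t * 0"
      using that by (simp add: if_distrib cong: if_cong)
    also have "\<dots> \<in> I"
      using ideal.R_one supported_on_zero by (intro I_intro) auto
    finally show ?thesis .
  qed
  have tI: "t \<in> I"
    using I_intro[of "\<lambda>j. 0" 1] ideal.R_one by (simp add: supported_on_zero)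
  interpret monoid_point D \<mu>
  proof
    show "finite D" using P(3) by (simp add: D_def)
    show "\<mu> 0 = 1" using \<phi>(1)[of 1] by (simp add: \<mu>_def)
    show "\<mu> (x + y) = \<mu> x * \<mu> y" if "x \<in> monoid_hull D" "y \<in> monoid_hull D" for x y
      using \<phi>(3)[of "Poly_Mapping.single x 1" "Poly_Mapping.single y 1"] that
      by (simp add: \<mu>_def mult_single supported_on_single M)
  qed
  obtain u \<kappa> where u: "\<And>d. d \<in> D \<Longrightarrow> 0 \<le> u \<bullet> real_vec d" and \<kappa>: "character_on UNIV \<kappa>"
    and \<mu>: "\<And>x. x \<in> monoid_hull D \<Longrightarrow> \<mu> x = (if u \<bullet> real_vec x = 0 then \<kappa> x else 0)"
    using face_character by blast
  obtain \<Delta> where \<Delta>: "complete_fan \<Delta>" "compatible_fan P \<Delta>" "first_orthant \<in> \<Delta>"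
    "\<not> (\<exists>p\<in>variety_at_infinity \<Delta>. \<forall>j\<in>{1..m}. section_zero P (F j) p)"
    using no_zeros unfolding no_common_zeros_at_infinity_def by blast
  obtain \<sigma> where \<sigma>: "\<sigma> \<in> \<Delta>" "u \<in> \<sigma>"
    using \<Delta>(1) unfolding complete_fan_def by (metis UNIV_I UnionE)
  obtain w where w: "cone_vertex P \<sigma> w"
    using \<Delta>(2) \<sigma>(1) by (auto simp: compatible_fan_def)
  then have wP: "real_vec w \<in> P" and w_min: "\<And>u' x. u' \<in> \<sigma> \<Longrightarrow> x \<in> P \<Longrightarrow> u' \<bullet> real_vec w \<le> u' \<bullet> x"
    by (auto simp: cone_vertex_def extreme_point_of_def)
  \<comment> \<open>\<open>u\<close> is minimal over \<open>P\<close> at \<open>w\<close> because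
    \<open>u\<close> lies in the cone, and no lattice point of \<open>P\<close> has a smaller value
    than \<open>v\<close> because \<open>u\<close> is nonnegative on \<open>D\<close>.\<close>
  have u_w: "u \<bullet> real_vec w = u \<bullet> real_vec v"
    using w_min[OF \<sigma>(2) v] u[of "w - v"] wP by (auto simp: D_def real_vec_diff inner_diff_right)
  define g where "g a = (if u \<bullet> real_vec a = 0 then \<kappa> a else 0)" for a
  define \<psi> where "\<psi> = face_point \<sigma> u \<kappa>"
  have \<psi>: "\<psi> \<in> chart \<sigma>" unfolding \<psi>_def using \<sigma>(2) \<kappa> by (rule face_point_chart)
  have \<psi>_eval: "\<psi> f = eval_exp g f" if "f \<in> coord_ring \<sigma>" for f
    using that by (simp add: \<psi>_def face_point_def g_def[abs_def])
  \<comment> \<open>Changing the trivialization from \<open>v\<close> to \<open>w\<close> costs the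
    factor \<open>\<kappa> (v - w)\<close>, so the zeros found at \<open>v\<close> persist at
    \<open>w\<close>.\<close>
  have g_shift: "g (- w + a) = \<kappa> (v - w) * \<mu> (- v + a)" if a: "real_vec a \<in> P" for a
  proof -
    have "- v + a \<in> monoid_hull D" using a by (auto simp: D_def intro!: monoid_hull_base)
    moreover have "u \<bullet> real_vec (- w + a) = u \<bullet> real_vec (- v + a)"
      using u_w by (simp add: real_vec_diff inner_diff_right)
    moreover have "\<kappa> (- w + a) = \<kappa> (v - w) * \<kappa> (- v + a)"
      using character_on_add(2)[OF \<kappa>, of "v - w" "- v + a"] by (simp add: algebra_simps)
    ultimately show ?thesis using \<mu>[of "- v + a"] by (simp add: g_def)
  qed
  have \<psi>_zero: "\<psi> (local_section w (F j)) = 0" if j: "j \<in> {1..m}" for j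
  proof -
    have "laurent_of (F j) \<in> supported_on {y. real_vec y \<in> P}"
      using key_P[OF j] by (auto simp: supported_on_def)
    with supported_on_single[of "- w" "{- w}"]
    have "local_section w (F j) \<in> coord_ring \<sigma>"
      unfolding local_section_def coord_ring_eq_supported_on
      by (rule supported_on_mult)
        (auto simp: dual_cone_def real_vec_diff inner_diff_right intro: w_min)
    then have "\<psi> (local_section w (F j)) = (\<Sum>a\<in>Poly_Mapping.keys (laurent_of (F j)).
        Poly_Mapping.lookup (laurent_of (F j)) a * g (- w + a))"
      by (simp add: \<psi>_eval local_section_def eval_exp_single_mult)
    also have "\<dots> = \<kappa> (v - w) * eval_exp \<mu> (s j)"
      unfolding s_def local_section_def eval_exp_single_mult sum_distrib_left
      using g_shift key_P[OF j] by (intro sum.cong) (auto simp: ac_simps)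
    also have "eval_exp \<mu> (s j) = 0" using \<phi>(4)[OF sI[OF j]] \<phi>_eval[OF s_M[OF j]] by simp
    finally show ?thesis by simp
  qed
  define p where "p = glue \<Delta> `` {(\<sigma>, \<psi>)}"
  have self: "(\<sigma>, \<psi>) \<in> p" unfolding p_def using glue_refl[OF \<sigma>(1) \<psi>] by blast
  have toric: "p \<in> toric_variety \<Delta>"
    unfolding toric_variety_def p_def using \<sigma>(1) \<psi> by (intro quotientI) simp
  \<comment> \<open>The monomial with exponent \<open>- w\<close> vanishes at \<open>\<psi>\<close> but is a unit on the overlap with the first orthant.\<close>
  have "p \<notin> chart_image \<Delta> first_orthant"
  proof
    assume "p \<in> chart_image \<Delta> first_orthant"
    then obtain \<phi>' where "p = glue \<Delta> `` {(first_orthant, \<phi>')}"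
      by (auto simp: chart_image_def)
    with self have "((first_orthant, \<phi>'), (\<sigma>, \<psi>)) \<in> glue \<Delta>" by blast
    then obtain \<psi>' where \<psi>': "\<psi>' \<in> chart (first_orthant \<inter> \<sigma>)" "\<psi> = restrict \<psi>' (coord_ring \<sigma>)"
      unfolding glue_def by blast
    let ?x = "Poly_Mapping.single (- w) (1::complex)" and ?y = "Poly_Mapping.single w (1::complex)"
    have neg: "0 \<le> u' \<bullet> real_vec (- w)" if "u' \<in> \<sigma>" for u'
      using w_min[OF that P(2)] by (simp add: real_vec_uminus)
    have pos: "0 \<le> u' \<bullet> real_vec w" if "u' \<in> first_orthant" for u'
    proof -
      have "real_vec w \<in> first_orthant" using wP P(1) by blast
      with that show ?thesis by (simp add: first_orthant_def inner_vec_def sum_nonneg)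
    qed
    have x: "?x \<in> coord_ring \<sigma>" using neg by (simp add: coord_ring_def dual_cone_def)
    have "\<psi>' (?x * ?y) = \<psi>' ?x * \<psi>' ?y"
      by (rule chart_mult[OF \<psi>'(1)]) (use neg pos in \<open>auto simp: coord_ring_def dual_cone_def\<close>)
    then have "\<psi>' ?x \<noteq> 0" using chart_const[OF \<psi>'(1), of 1] by (auto simp: mult_single)
    then have "g (- w) \<noteq> 0" using x \<psi>'(2) \<psi>_eval[OF x] by simp
    moreover have "g (- w) = 0"
      using g_shift[of 0] P(2) \<phi>(4)[OF tI] by (simp add: \<mu>_def t_def)
    ultimately show False by simp
  qed
  with toric have "p \<in> variety_at_infinity \<Delta>" by (simp add: variety_at_infinity_def)
  moreover have "section_zero P (F j) p" if "j \<in> {1..m}" for j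
    unfolding section_zero_def
    by (rule bexI[OF _ self]) (use w \<psi>_zero[OF that] in auto)
  ultimately show False using \<Delta>(4) by blast
qed

section \<open>Polynomials supported in multiples of the polytope\<close>

lemma inj_real_vec: "inj real_vec"
  by (auto simp: inj_def real_vec_def vec_eq_iff)

lemma finite_lattice_points:
  fixes X :: "(real ^ 'n::finite) set"
  assumes "bounded X"
  shows "finite {a. real_vec a \<in> X}"
proof -
  obtain b where b: "\<And>x. x \<in> X \<Longrightarrow> norm x \<le> b" using assms by (auto simp: bounded_iff)
  have "{a. real_vec a \<in> X} \<subseteq> vec_lambda ` (UNIV \<rightarrow>\<^sub>E {-\<lceil>b\<rceil>..\<lceil>b\<rceil>})"
  proof
    fix a :: "int ^ 'n" assume "a \<in> {a. real_vec a \<in> X}"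
    then have "norm (real_vec a) \<le> b" using b by blast
    have "a $ i \<in> {-\<lceil>b\<rceil>..\<lceil>b\<rceil>}" for i
    proof -
      have "\<bar>real_vec a $ i\<bar> \<le> b"
        using component_le_norm_cart[of "real_vec a" i] \<open>norm (real_vec a) \<le> b\<close> by linarith
      then have "\<bar>real_of_int (a $ i)\<bar> \<le> b" by (simp add: real_vec_def)
      then show ?thesis by (simp; linarith)
    qed
    then show "a \<in> vec_lambda ` (UNIV \<rightarrow>\<^sub>E {-\<lceil>b\<rceil>..\<lceil>b\<rceil>})"
      by (intro image_eqI[of _ _ "($) a"]) (auto simp: PiE_UNIV_domain)
  qed
  then show ?thesis by (rule finite_subset) (simp add: finite_PiE)
qed

text \<open>Values of \<open>F\<close> at different indices may coincide, so the induction along the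
  span keeps coefficients by index and changes one index at a time.\<close>

lemma gen_ideal_image_subset:
  assumes "\<Phi> \<in> gen_ideal (F ` A)" "finite A"
  obtains G where "\<Phi> = (\<Sum>j\<in>A. F j * G j)"
proof -
  have module: "module ((*) :: 'a::comm_ring_1 \<Rightarrow> 'a \<Rightarrow> 'a)"
    by unfold_locales (simp_all add: algebra_simps)
  have "\<exists>G. \<Phi> = (\<Sum>j\<in>A. F j * G j)"
    using assms(1) unfolding gen_ideal_def
  proof (induction rule: module.span_induct_alt[OF module, consumes 1])
    case 1
    show ?case by (intro exI[of _ "\<lambda>j. 0"]) simp
  next
    case (2 c x y)
    then obtain i G where "i \<in> A" "x = F i" "y = (\<Sum>j\<in>A. F j * G j)" by blast
    then have "c * x + y = (\<Sum>j\<in>A. F j * (G j + (if j = i then c else 0)))"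
      using \<open>finite A\<close> by (simp add: distrib_left sum.distrib if_distrib[of "\<lambda>c. _ * c"] mult.commute cong: if_cong)
    then show ?case by (rule exI[of _ "\<lambda>j. G j + (if j = i then c else 0)"])
  qed
  with that show thesis by blast
qed

locale origin_polytope =
  fixes P :: "(real ^ 'n::finite) set" and S :: "(int ^ 'n) set"
  assumes finite_S: "finite S" and hull: "P = convex hull (real_vec ` S)" and zero_P: "0 \<in> P"
begin

lemma convex_P: "convex P"
  by (simp add: hull convex_convex_hull)

lemma bounded_P: "bounded P"
  using finite_S by (simp add: hull bounded_convex_hull finite_imp_bounded)

lemma scaled_mono:
  assumes "0 \<le> a" "a \<le> b"
  shows "(*\<^sub>R) a ` P \<subseteq> (*\<^sub>R) b ` P"
proof (cases "b = 0")
  case True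
  then show ?thesis using assms by simp
next
  case False
  have "a *\<^sub>R p \<in> (*\<^sub>R) b ` P" if "p \<in> P" for p
  proof (rule image_eqI)
    show "a *\<^sub>R p = b *\<^sub>R ((a / b) *\<^sub>R p)" using False by simp
    show "(a / b) *\<^sub>R p \<in> P"
      using convexD_alt[OF convex_P zero_P that, of "a / b"] assms False by simp
  qed
  then show ?thesis by blast
qed

lemma scaled_add:
  assumes "0 \<le> a" "0 \<le> b" "x \<in> (*\<^sub>R) a ` P" "y \<in> (*\<^sub>R) b ` P"
  shows "x + y \<in> (*\<^sub>R) (a + b) ` P"
proof (cases "a + b = 0")
  case True
  then have "a = 0" "b = 0" using assms by auto
  then show ?thesis using assms zero_P by auto
next
  case False
  obtain p q where pq: "p \<in> P" "q \<in> P" "x = a *\<^sub>R p" "y = b *\<^sub>R q" using assms by blast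
  have "(a / (a + b)) *\<^sub>R p + (b / (a + b)) *\<^sub>R q \<in> P"
    using assms False pq by (intro convexD[OF convex_P]) (auto simp flip: add_divide_distrib)
  moreover have "x + y = (a + b) *\<^sub>R ((a / (a + b)) *\<^sub>R p + (b / (a + b)) *\<^sub>R q)"
    using False by (simp add: pq scaleR_add_right)
  ultimately show ?thesis by blast
qed

text \<open>The space \<open>S_e\<close> of the overview, for real \<open>e\<close>. For negative
  \<open>e\<close> the scaled set is a reflected multiple of \<open>P\<close>, hence the sign
  hypotheses in the lemmas below.\<close>

definition sections :: "real \<Rightarrow> 'n laurent set" where
  "sections e = supported_on {a. real_vec a \<in> (*\<^sub>R) e ` P}"

lemma sections_mono: "0 \<le> a \<Longrightarrow> a \<le> b \<Longrightarrow> sections a \<subseteq> sections b"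
  unfolding sections_def using scaled_mono by (intro supported_on_mono) blast

lemma sections_mult:
  assumes "0 \<le> a" "0 \<le> b" "f \<in> sections a" "g \<in> sections b"
  shows "f * g \<in> sections (a + b)"
  using assms(3,4) unfolding sections_def
  by (rule supported_on_mult) (auto simp: real_vec_add intro: scaled_add[OF assms(1,2)])

lemma sections_add: "f \<in> sections e \<Longrightarrow> g \<in> sections e \<Longrightarrow> f + g \<in> sections e"
  unfolding sections_def by (rule supported_on_add)

lemma sections_zero: "0 \<in> sections e"
  unfolding sections_def by (rule supported_on_zero)

lemma sections_sum: "(\<And>i. i \<in> A \<Longrightarrow> f i \<in> sections e) \<Longrightarrow> sum f A \<in> sections e"
  unfolding sections_def by (rule supported_on_sum)

lemma single_sections: "real_vec a \<in> (*\<^sub>R) e ` P \<Longrightarrow> Poly_Mapping.single a c \<in> sections e"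
  unfolding sections_def by (rule supported_on_single) simp

lemma const_mult_sections: "f \<in> sections e \<Longrightarrow> const c * f \<in> sections e"
  unfolding sections_def
  by (rule supported_on_mult[OF supported_on_single[of 0 "{0}"]]) auto

lemma finite_scaled: "finite {a. real_vec a \<in> (*\<^sub>R) e ` P}"
  by (rule finite_lattice_points) (rule bounded_scaling[OF bounded_P])

text \<open>Each generator \<open>y - v\<close> trades one copy of \<open>v\<close> for a point
  \<open>y\<close> of \<open>P\<close>. With enough copies of \<open>v\<close>, the result is a sum
  of \<open>k\<close> points of \<open>P\<close>.\<close>

lemma monoid_hull_scaled:
  assumes v: "real_vec v \<in> P" and x: "x \<in> monoid_hull ((\<lambda>y. y - v) ` {y. real_vec y \<in> P})"
  shows "\<exists>k\<^sub>0::nat. \<forall>k\<ge>k\<^sub>0. real_vec (int k *s v + x) \<in> (*\<^sub>R) (real k) ` P"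
  using x
proof induction
  case zero
  have "real_vec (int k *s v + 0) = real k *\<^sub>R real_vec v" for k
    by (simp add: real_vec_def vec_eq_iff)
  then show ?case using v by blast
next
  case (step d x)
  then obtain k\<^sub>0 y where k\<^sub>0: "\<forall>k\<ge>k\<^sub>0. real_vec (int k *s v + x) \<in> (*\<^sub>R) (real k) ` P"
    and y: "real_vec y \<in> P" "d = y - v" by blast
  have "real_vec (int k *s v + (d + x)) \<in> (*\<^sub>R) (real k) ` P" if "k \<ge> Suc k\<^sub>0" for k
  proof -
    obtain l where l: "k = Suc l" "l \<ge> k\<^sub>0" using \<open>k \<ge> Suc k\<^sub>0\<close> by (cases k) auto
    have "int k *s v + (d + x) = (int l *s v + x) + y"
      by (simp add: l y vector_sadd_rdistrib algebra_simps)
    moreover have "real_vec (int l *s v + x) + real_vec y \<in> (*\<^sub>R) (real l + 1) ` P"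
      using k\<^sub>0 l y by (intro scaled_add) auto
    ultimately show ?thesis using l by (metis real_vec_add add.commute of_nat_Suc)
  qed
  then show ?case by blast
qed

text \<open>Clearing denominators: the finitely many exponents of \<open>f\<close> have a common
  bound on the power of \<open>z^v\<close> that they require.\<close>

lemma supported_on_monoid_hull_sections:
  assumes v: "real_vec v \<in> P"
    and f: "f \<in> supported_on (monoid_hull ((\<lambda>y. y - v) ` {y. real_vec y \<in> P}))"
  shows "\<exists>k\<^sub>0::nat. \<forall>k\<ge>k\<^sub>0. Poly_Mapping.single (int k *s v) 1 * f \<in> sections (real k)"
proof -
  have "\<forall>x\<in>Poly_Mapping.keys f. \<exists>k\<^sub>0::nat. \<forall>k\<ge>k\<^sub>0. real_vec (int k *s v + x) \<in> (*\<^sub>R) (real k) ` P"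
    using monoid_hull_scaled[OF v] f unfolding supported_on_def by blast
  then obtain h where h: "\<And>x k. x \<in> Poly_Mapping.keys f \<Longrightarrow> (k::nat) \<ge> h x \<Longrightarrow>
      real_vec (int k *s v + x) \<in> (*\<^sub>R) (real k) ` P"
    by metis
  have "Poly_Mapping.single (int k *s v) 1 * f \<in> sections (real k)"
    if k: "k \<ge> (\<Sum>x\<in>Poly_Mapping.keys f. h x)" for k
  proof -
    have "k \<ge> h x" if "x \<in> Poly_Mapping.keys f" for x
      using member_le_sum[OF that, of h] k by simp
    then have "f \<in> supported_on {x. real_vec (int k *s v + x) \<in> (*\<^sub>R) (real k) ` P}"
      using h by (auto simp: supported_on_def)
    with supported_on_single[of "int k *s v" "{int k *s v}"] show ?thesis
      unfolding sections_def by (rule supported_on_mult) auto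
  qed
  then show ?thesis by blast
qed

text \<open>Pigeonhole: in a convex combination of \<open>N\<close> points some coefficient is at least \<open>1 / N\<close>.\<close>

lemma scaled_split:
  assumes x: "real_vec a \<in> (*\<^sub>R) e ` P" and e: "real (card S) * real K < e"
  obtains s where "s \<in> S" "real_vec (a - int K *s s) \<in> (*\<^sub>R) (e - real K) ` P"
proof -
  obtain p where p: "p \<in> P" "real_vec a = e *\<^sub>R p" using x by blast
  then obtain c where c: "\<forall>y\<in>real_vec ` S. 0 \<le> c y" "sum c (real_vec ` S) = 1"
    "p = (\<Sum>y\<in>real_vec ` S. c y *\<^sub>R y)"
    using finite_S by (auto simp: hull convex_hull_finite)
  define l where "l s = c (real_vec s)" for s
  have l: "\<And>s. s \<in> S \<Longrightarrow> 0 \<le> l s" "sum l S = 1" "p = (\<Sum>s\<in>S. l s *\<^sub>R real_vec s)"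
    using c by (auto simp: l_def sum.reindex inj_on_subset[OF inj_real_vec])
  have "S \<noteq> {}" using l(2) by auto
  then have N: "1 \<le> real (card S)" using finite_S by (simp add: card_gt_0_iff Suc_leI)
  then have Ke: "real K < e"
    using e mult_right_mono[of 1 "real (card S)" "real K"] by simp
  have "\<exists>s\<in>S. real K \<le> e * l s"
  proof (rule ccontr)
    assume "\<not> ?thesis"
    then have "(\<Sum>s\<in>S. e * l s) \<le> (\<Sum>s\<in>S. real K)"
      by (intro sum_mono) auto
    then show False using e l(2) by (simp flip: sum_distrib_left)
  qed
  then obtain s where s: "s \<in> S" "real K \<le> e * l s" by blast
  \<comment> \<open>The weights left after removing \<open>K\<close> copies of \<open>s\<close>,
    normalized to have sum \<open>1\<close>.\<close>
  define r where "r t = (e * l t - (if t = s then real K else 0)) / (e - real K)" for t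
  have "(\<Sum>t\<in>S. r t *\<^sub>R real_vec t) \<in> P"
    unfolding hull
  proof (rule convex_sum[OF finite_S convex_convex_hull])
    show "0 \<le> r t" if "t \<in> S" for t
      using s l(1)[OF that] Ke unfolding r_def by (intro divide_nonneg_pos) auto
    show "real_vec t \<in> convex hull real_vec ` S" if "t \<in> S" for t
      using that by (simp add: hull_inc)
    have "sum r S = (e * sum l S - real K) / (e - real K)"
      using s finite_S
      by (simp add: r_def sum_subtractf sum_distrib_left flip: sum_divide_distrib)
    then show "sum r S = 1" using l(2) Ke by simp
  qed
  moreover have "real_vec (a - int K *s s) = (e - real K) *\<^sub>R (\<Sum>t\<in>S. r t *\<^sub>R real_vec t)"
  proof -
    have "(e - real K) *\<^sub>R (\<Sum>t\<in>S. r t *\<^sub>R real_vec t)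
        = (\<Sum>t\<in>S. (e * l t) *\<^sub>R real_vec t - (if t = s then real K *\<^sub>R real_vec s else 0))"
      unfolding scaleR_right.sum using Ke
      by (intro sum.cong) (auto simp: r_def scaleR_diff_left)
    also have "\<dots> = e *\<^sub>R p - real K *\<^sub>R real_vec s"
      using s finite_S by (simp add: sum_subtractf l(3) scaleR_right.sum)
    also have "real K *\<^sub>R real_vec s = real_vec (int K *s s)"
      by (simp add: real_vec_def vec_eq_iff)
    finally show ?thesis using p by (simp add: real_vec_diff)
  qed
  ultimately show thesis using s(1) that by blast
qed

end

section \<open>Lowering degrees modulo the given polynomials\<close>

locale sparse_system = origin_polytope P S
  for P :: "(real ^ 'n::finite) set" and S :: "(int ^ 'n) set" +
  fixes m :: nat and F :: "nat \<Rightarrow> 'n cpoly"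
  assumes orthant: "P \<subseteq> first_orthant"
    and supp_F: "\<And>j. j \<in> {1..m} \<Longrightarrow> supp (F j) \<subseteq> P"
    and axis_P: "\<And>i. axis i 1 \<in> P"
    and no_zeros: "no_common_zeros_at_infinity P m F"
begin

definition f :: "nat \<Rightarrow> 'n laurent" where
  "f j = laurent_of (F j)"

text \<open>The space \<open>J_e\<close> of the overview. The cofactors have nonnegative degree only
  from \<open>e = 1\<close> on, which explains the lower bounds \<open>1\<close> on degrees
  below.\<close>

definition J :: "real \<Rightarrow> 'n laurent set" where
  "J e = {(\<Sum>j = 1..m. f j * g j) | g. \<forall>j. g j \<in> sections (e - 1)}"

lemma f_sections: "j \<in> {1..m} \<Longrightarrow> f j \<in> sections 1"
  using supp_F[of j] by (auto simp: f_def sections_def supported_on_def supp_eq_real_vec_keys)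

lemma J_intro: "(\<And>j. g j \<in> sections (e - 1)) \<Longrightarrow> (\<Sum>j = 1..m. f j * g j) \<in> J e"
  unfolding J_def by blast

lemma J_elim:
  assumes "x \<in> J e"
  shows "\<exists>g. x = (\<Sum>j = 1..m. f j * g j) \<and> (\<forall>j. g j \<in> sections (e - 1))"
  using assms unfolding J_def by blast

lemma J_zero: "0 \<in> J e"
  using J_intro[of "\<lambda>j. 0" e] by (simp add: sections_zero)

lemma J_add:
  assumes "x \<in> J e" "y \<in> J e"
  shows "x + y \<in> J e"
proof -
  obtain g h where "x = (\<Sum>j = 1..m. f j * g j)" "\<And>j. g j \<in> sections (e - 1)"
    "y = (\<Sum>j = 1..m. f j * h j)" "\<And>j. h j \<in> sections (e - 1)"
    using J_elim[OF assms(1)] J_elim[OF assms(2)] by blast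
  then show ?thesis
    using J_intro[of "\<lambda>j. g j + h j" e] by (simp add: sections_add distrib_left sum.distrib)
qed

lemma J_mono:
  assumes "1 \<le> a" "a \<le> b"
  shows "J a \<subseteq> J b"
proof
  fix x assume "x \<in> J a"
  then obtain g where "x = (\<Sum>j = 1..m. f j * g j)" "\<And>j. g j \<in> sections (a - 1)"
    using J_elim[of x a] by blast
  then show "x \<in> J b"
    using J_intro[of g b] sections_mono[of "a - 1" "b - 1"] assms by auto
qed

lemma J_mult:
  assumes "1 \<le> a" "0 \<le> b" "x \<in> J a" "h \<in> sections b"
  shows "x * h \<in> J (a + b)"
proof -
  obtain g where g: "x = (\<Sum>j = 1..m. f j * g j)" "\<And>j. g j \<in> sections (a - 1)"
    using J_elim[OF assms(3)] by blast
  have "g j * h \<in> sections (a + b - 1)" for j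
    using sections_mult[OF _ assms(2) g(2) assms(4), of j] assms(1) by (simp add: algebra_simps)
  then show ?thesis
    using J_intro[of "\<lambda>j. g j * h" "a + b"] by (simp add: g(1) sum_distrib_right mult.assoc)
qed

lemma J_const_mult:
  assumes "x \<in> J e"
  shows "const c * x \<in> J e"
proof -
  obtain g where "x = (\<Sum>j = 1..m. f j * g j)" "\<And>j. g j \<in> sections (e - 1)"
    using J_elim[OF assms] by blast
  then show "const c * x \<in> J e"
    using J_intro[of "\<lambda>j. const c * g j" e]
    by (simp add: const_mult_sections sum_distrib_left mult.left_commute)
qed

text \<open>Multiply the local identity for \<open>1\<close> by \<open>z^(k v)\<close>. Validity for
  all large \<open>k\<close>, not just for one, is needed to choose the same exponent for all points
  of \<open>S\<close>.\<close>

lemma vertex_power: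
  assumes v: "real_vec v \<in> P"
  shows "\<exists>k\<^sub>0::nat. \<forall>k\<ge>k\<^sub>0. 1 \<le> k \<and> (\<exists>x\<in>J (real k). \<exists>y\<in>sections (real k - 1).
    Poly_Mapping.single (int k *s v) 1 = x + y)"
proof -
  let ?M = "monoid_hull ((\<lambda>y. y - v) ` {y. real_vec y \<in> P})"
  have "finite {y. real_vec y \<in> P}" using bounded_P by (rule finite_lattice_points)
  then have "\<exists>a b. (\<forall>j\<in>{1..m}. a j \<in> supported_on ?M) \<and> b \<in> supported_on ?M \<and>
      1 = (\<Sum>j = 1..m. local_section v (F j) * a j) + Poly_Mapping.single (- v) 1 * b"
    by (rule local_sections_generate[OF orthant zero_P _ _ no_zeros v]) (rule supp_F)
  then obtain a b where a: "\<forall>j\<in>{1..m}. a j \<in> supported_on ?M" and b: "b \<in> supported_on ?M"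
    and eq: "1 = (\<Sum>j = 1..m. local_section v (F j) * a j) + Poly_Mapping.single (- v) 1 * b"
    by (elim exE conjE)
  have "\<forall>j\<in>{1..m}. \<exists>k\<^sub>0::nat. \<forall>k\<ge>k\<^sub>0. Poly_Mapping.single (int k *s v) 1 * a j \<in> sections (real k)"
    by (intro ballI supported_on_monoid_hull_sections[OF v] a[rule_format])
  then obtain ka :: "nat \<Rightarrow> nat" where ka: "\<forall>j\<in>{1..m}. \<forall>k\<ge>ka j.
      Poly_Mapping.single (int k *s v) 1 * a j \<in> sections (real k)"
    by (elim bchoice[THEN exE])
  obtain kb where kb: "\<forall>k\<ge>kb. Poly_Mapping.single (int k *s v) 1 * b \<in> sections (real k)"
    using supported_on_monoid_hull_sections[OF v b] by (elim exE)
  have "\<exists>x\<in>J (real k). \<exists>y\<in>sections (real k - 1). Poly_Mapping.single (int k *s v) 1 = x + y"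
    if k: "k \<ge> Suc ((\<Sum>j = 1..m. ka j) + kb)" for k
  proof -
    \<comment> \<open>One factor \<open>z^v\<close> cancels the \<open>z^(-v)\<close> of the local
      sections; the remaining \<open>l = k - 1\<close> factors clear the denominators of the
      cofactors.\<close>
    obtain l where l: "k = Suc l" "l \<ge> (\<Sum>j = 1..m. ka j)" "l \<ge> kb" using k by (cases k) auto
    let ?z = "Poly_Mapping.single (int l *s v) (1::complex)"
    define g where "g j = (if j \<in> {1..m} then ?z * a j else 0)" for j
    have "l \<ge> ka j" if "j \<in> {1..m}" for j
      using member_le_sum[OF that, of ka] l(2) by simp
    then have "g j \<in> sections (real k - 1)" for j
      using ka l(1) by (cases "j \<in> {1..m}") (simp_all add: g_def sections_zero)
    then have "(\<Sum>j = 1..m. f j * g j) \<in> J (real k)" by (rule J_intro)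
    moreover have "?z * b \<in> sections (real k - 1)" using kb l(1,3) by simp
    moreover have "Poly_Mapping.single (int k *s v) 1 = (\<Sum>j = 1..m. f j * g j) + ?z * b"
    proof -
      let ?w = "Poly_Mapping.single (int k *s v) (1::complex)"
      have w: "?w * Poly_Mapping.single (- v) 1 = ?z"
        by (simp add: mult_single l(1) vector_sadd_rdistrib)
      have "?w = ?w * ((\<Sum>j = 1..m. local_section v (F j) * a j) + Poly_Mapping.single (- v) 1 * b)"
        unfolding eq[symmetric] by simp
      also have "\<dots> = (\<Sum>j = 1..m. f j * ((?w * Poly_Mapping.single (- v) 1) * a j))
          + (?w * Poly_Mapping.single (- v) 1) * b"
        by (simp add: distrib_left sum_distrib_left local_section_def f_def ac_simps)
      also have "\<dots> = (\<Sum>j = 1..m. f j * g j) + ?z * b"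
        unfolding w by (simp add: g_def)
      finally show ?thesis .
    qed
    ultimately show ?thesis by blast
  qed
  then show ?thesis by (intro exI[of _ "Suc ((\<Sum>j = 1..m. ka j) + kb)"]) auto
qed

text \<open>A monomial of large degree contains \<open>z^(K s)\<close> for some \<open>s\<close> in
  \<open>S\<close>. Multiplying the identity of \<open>vertex_power\<close> by the remaining
  monomial lowers the degree by one modulo \<open>J e\<close>.\<close>

lemma reduce_degree:
  "\<exists>K\<^sub>0\<ge>1. \<forall>e\<ge>K\<^sub>0. \<forall>x\<in>sections e. \<exists>y\<in>J e. \<exists>z\<in>sections (e - 1). x = y + z"
proof -
  have "\<forall>s\<in>S. \<exists>k\<^sub>0::nat. \<forall>k\<ge>k\<^sub>0. 1 \<le> k \<and> (\<exists>x\<in>J (real k). \<exists>y\<in>sections (real k - 1).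
      Poly_Mapping.single (int k *s s) 1 = x + y)"
    by (intro ballI vertex_power) (simp add: hull hull_inc)
  then obtain h where h: "\<And>s k. s \<in> S \<Longrightarrow> (k::nat) \<ge> h s \<Longrightarrow> 1 \<le> k \<and> (\<exists>x\<in>J (real k). \<exists>y\<in>sections (real k - 1).
      Poly_Mapping.single (int k *s s) 1 = x + y)"
    by metis
  \<comment> \<open>The sum bounds all thresholds \<open>h s\<close> at once, and the successor
    keeps \<open>K - 1\<close> nonnegative.\<close>
  define K where "K = Suc (\<Sum>s\<in>S. h s)"
  have K: "\<exists>x\<in>J (real K). \<exists>y\<in>sections (real K - 1). Poly_Mapping.single (int K *s s) 1 = x + y"
    if "s \<in> S" for s
    using h[OF that, of K] member_le_sum[OF that, of h] finite_S by (simp add: K_def)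
  \<comment> \<open>The product in the bound is the pigeonhole threshold of
    \<open>scaled_split\<close>; the summand \<open>K\<close> keeps \<open>e - K\<close>
    nonnegative, and \<open>1\<close> makes the threshold strict.\<close>
  have single: "\<exists>y\<in>J e. \<exists>z\<in>sections (e - 1). Poly_Mapping.single a c = y + z"
    if e: "real (card S) * real K + real K + 1 \<le> e" and a: "real_vec a \<in> (*\<^sub>R) e ` P" for e a c
  proof -
    have "real (card S) * real K < e" using e by simp
    from scaled_split[OF a this] obtain s
      where s: "s \<in> S" "real_vec (a - int K *s s) \<in> (*\<^sub>R) (e - real K) ` P" .
    obtain x y where xy: "x \<in> J (real K)" "y \<in> sections (real K - 1)"
      "Poly_Mapping.single (int K *s s) 1 = x + y" using K[OF s(1)] by blast
    let ?g = "Poly_Mapping.single (a - int K *s s) c"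
    have g: "?g \<in> sections (e - real K)" using s(2) by (rule single_sections)
    have eK: "0 \<le> e - real K"
    proof -
      have "0 \<le> real (card S) * real K" by simp
      then show ?thesis using e by linarith
    qed
    have K1: "1 \<le> real K" "0 \<le> real K - 1" by (simp_all add: K_def sum_nonneg)
    have "x * ?g \<in> J e" using J_mult[OF K1(1) eK xy(1) g] by simp
    moreover have "y * ?g \<in> sections (e - 1)"
      using sections_mult[OF K1(2) eK xy(2) g] by simp
    moreover have "Poly_Mapping.single a c = x * ?g + y * ?g"
      by (simp add: mult_single flip: distrib_right xy(3))
    ultimately show ?thesis by blast
  qed
  show ?thesis
  proof (intro exI conjI allI impI ballI)
    show "1 \<le> real (card S) * real K + real K + 1" by simp
    fix e x
    assume e: "real (card S) * real K + real K + 1 \<le> e" and x: "x \<in> sections e"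
    have "\<exists>y z. y \<in> J e \<and> z \<in> sections (e - 1) \<and>
        Poly_Mapping.single a (Poly_Mapping.lookup x a) = y + z" if "a \<in> Poly_Mapping.keys x" for a
      using single[OF e, of a] x that unfolding sections_def supported_on_def by blast
    then obtain y z where yz: "\<And>a. a \<in> Poly_Mapping.keys x \<Longrightarrow> y a \<in> J e \<and> z a \<in> sections (e - 1) \<and>
        Poly_Mapping.single a (Poly_Mapping.lookup x a) = y a + z a"
      by metis
    have "x = (\<Sum>a\<in>Poly_Mapping.keys x. y a) + (\<Sum>a\<in>Poly_Mapping.keys x. z a)"
      using yz by (subst poly_mapping_sum_singles) (simp flip: sum.distrib)
    moreover have "(\<Sum>a\<in>A. y a) \<in> J e" if "finite A" "A \<subseteq> Poly_Mapping.keys x" for A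
      using that by (induction A) (auto simp: J_zero yz intro: J_add)
    moreover have "(\<Sum>a\<in>Poly_Mapping.keys x. z a) \<in> sections (e - 1)"
      using yz by (intro sections_sum) blast
    ultimately show "\<exists>y\<in>J e. \<exists>z\<in>sections (e - 1). x = y + z"
      by (metis finite_keys order_refl)
  qed
qed

text \<open>Iterates \<open>reduce_degree\<close>. Since \<open>e\<close> is real, the induction
  runs over a natural number bounding \<open>e - K\<^sub>0\<close>; the last step may land below
  \<open>K\<^sub>0\<close>, but in nonnegative degree, where monotonicity applies.\<close>

lemma reduce_to_bounded_degree:
  "\<exists>K\<^sub>0\<ge>1. \<forall>e\<ge>K\<^sub>0. \<forall>x\<in>sections e. \<exists>y\<in>J e. \<exists>z\<in>sections K\<^sub>0. x = y + z"
proof -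
  obtain K\<^sub>0 where K\<^sub>0: "1 \<le> K\<^sub>0"
    "\<And>e x. K\<^sub>0 \<le> e \<Longrightarrow> x \<in> sections e \<Longrightarrow> \<exists>y\<in>J e. \<exists>z\<in>sections (e - 1). x = y + z"
    using reduce_degree by blast
  have "\<exists>y\<in>J e. \<exists>z\<in>sections K\<^sub>0. x = y + z"
    if "K\<^sub>0 \<le> e" "e \<le> K\<^sub>0 + real n" "x \<in> sections e" for n e x
    using that
  proof (induction n arbitrary: e x)
    case 0
    then have "x \<in> sections K\<^sub>0" by simp
    then show ?case using J_zero by force
  next
    case (Suc n)
    obtain y z where yz: "y \<in> J e" "z \<in> sections (e - 1)" "x = y + z"
      using K\<^sub>0(2) Suc.prems by blast
    show ?case
    proof (cases "K\<^sub>0 \<le> e - 1")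
      case True
      then obtain y' z' where "y' \<in> J (e - 1)" "z' \<in> sections K\<^sub>0" "z = y' + z'"
        using Suc.IH[of "e - 1" z] Suc.prems yz by auto
      moreover have "y' \<in> J e" using calculation J_mono[of "e - 1" e] True K\<^sub>0(1) by auto
      ultimately show ?thesis using yz J_add by (metis add.assoc)
    next
      case False
      then have "z \<in> sections K\<^sub>0" using sections_mono[of "e - 1" K\<^sub>0] yz Suc.prems K\<^sub>0(1) by auto
      then show ?thesis using yz by blast
    qed
  qed
  moreover have "\<exists>n::nat. e \<le> K\<^sub>0 + real n" for e
    using real_arch_simple[of "e - K\<^sub>0"] by (simp add: algebra_simps)
  ultimately show ?thesis using K\<^sub>0(1) by meson
qed

lemma J_subspace: "monoid_algebra.subspace (J e)"
  unfolding monoid_algebra.subspace_def using J_zero J_add J_const_mult by blast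

text \<open>Finitely many independent elements span all the \<open>x\<close> in question, and each
  lies in some \<open>J r\<close>. Since these spaces increase with \<open>r\<close> and are
  subspaces, one of them contains the span.\<close>

lemma bounded_degree_uniform:
  "\<exists>\<nu>\<ge>1. \<forall>x\<in>sections K. \<forall>r\<ge>1. x \<in> J r \<longrightarrow> x \<in> J \<nu>"
proof -
  define W where "W = sections K \<inter> (\<Union>r\<in>{1..}. J r)"
  obtain B where B: "B \<subseteq> W" "monoid_algebra.independent B" "W \<subseteq> monoid_algebra.span B"
    using monoid_algebra.maximal_independent_subset[of W] by blast
  let ?T = "(\<lambda>t. Poly_Mapping.single t (1::complex)) ` {a. real_vec a \<in> (*\<^sub>R) K ` P}"
  have "B \<subseteq> monoid_algebra.span ?T"
    using B(1) supported_on_span unfolding W_def sections_def by blast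
  then have "finite B"
    using monoid_algebra.independent_span_bound[OF _ B(2), of ?T] finite_scaled by blast
  have "\<forall>b\<in>B. \<exists>r. 1 \<le> r \<and> b \<in> J r" using B(1) unfolding W_def by auto
  then obtain r where r: "\<And>b. b \<in> B \<Longrightarrow> 1 \<le> r b \<and> b \<in> J (r b)" by metis
  \<comment> \<open>All \<open>r b\<close> are nonnegative, so the sum dominates each of them; the
    summand \<open>1\<close> gives \<open>1 \<le> \<nu>\<close> even for empty
    \<open>B\<close>.\<close>
  define \<nu> where "\<nu> = 1 + (\<Sum>b\<in>B. r b)"
  have "b \<in> J \<nu>" if "b \<in> B" for b
  proof -
    have "r b \<le> (\<Sum>b\<in>B. r b)"
      using r \<open>finite B\<close> by (intro member_le_sum[OF that]) (auto intro: order_trans[of _ 1])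
    then show ?thesis using J_mono[of "r b" \<nu>] r[OF that] by (auto simp: \<nu>_def)
  qed
  then have "monoid_algebra.span B \<subseteq> J \<nu>"
    by (intro monoid_algebra.span_minimal J_subspace) blast
  with B(3) have W: "W \<subseteq> J \<nu>" by blast
  show ?thesis
  proof (intro exI conjI ballI allI impI)
    show "1 \<le> \<nu>" unfolding \<nu>_def using r by (simp add: sum_nonneg order_trans[of 0 1])
    show "x \<in> J \<nu>" if "x \<in> sections K" "x \<in> J r" "1 \<le> r" for x r
      using that W unfolding W_def by auto
  qed
qed

text \<open>Here \<open>x \<in> J r\<close> expresses membership in the ideal, with \<open>r\<close>
  uncontrolled. The low-degree remainder of \<open>x\<close> inherits it from \<open>x\<close> and
  its part in \<open>J e\<close>, so \<open>bounded_degree_uniform\<close> places the remainder in a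
  space independent of \<open>r\<close>.\<close>

lemma saturated_in_large_degree:
  "\<exists>\<nu>\<ge>1. \<forall>e\<ge>\<nu>. \<forall>x\<in>sections e. \<forall>r\<ge>1. x \<in> J r \<longrightarrow> x \<in> J e"
proof -
  obtain K where K: "1 \<le> K"
    "\<And>e x. K \<le> e \<Longrightarrow> x \<in> sections e \<Longrightarrow> \<exists>y\<in>J e. \<exists>z\<in>sections K. x = y + z"
    using reduce_to_bounded_degree by blast
  obtain \<nu> where \<nu>: "1 \<le> \<nu>" "\<And>x r. x \<in> sections K \<Longrightarrow> x \<in> J r \<Longrightarrow> 1 \<le> r \<Longrightarrow> x \<in> J \<nu>"
    using bounded_degree_uniform[of K] by blast
  show ?thesis
  proof (intro exI[of _ "max K \<nu>"] conjI allI impI ballI)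
    fix e x r assume e: "max K \<nu> \<le> e" and x: "x \<in> sections e" "1 \<le> r" "x \<in> J r"
    obtain y z where yz: "y \<in> J e" "z \<in> sections K" "x = y + z"
      using K(2)[of e x] e x by auto
    let ?r = "max e r"
    have "x \<in> J ?r" "- y \<in> J ?r"
      using J_mono[of r ?r] J_mono[of e ?r] x yz(1) e \<nu>(1) J_const_mult[of y e "-1"]
      by (auto simp: single_uminus)
    then have "z \<in> J ?r" using J_add[of x ?r "- y"] yz(3) by simp
    then have "z \<in> J \<nu>" using \<nu>(2)[OF yz(2)] x(2) by simp
    then have "z \<in> J e" using J_mono[of \<nu> e] \<nu>(1) e by auto
    then show "x \<in> J e" using yz J_add by blast
  qed (use \<nu>(1) in simp)
qed

section \<open>Back to polynomials and their ideal\<close>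

text \<open>Here the unit vectors in \<open>P\<close> enter: a monomial is a product of as many
  coordinate functions as its total degree.\<close>

lemma real_vec_int_exp_scaled: "real_vec (int_exp a) \<in> (*\<^sub>R) (\<Sum>i\<in>UNIV. real (a $ i)) ` P"
proof -
  have "(\<Sum>i\<in>A. real (a $ i) *\<^sub>R axis i 1) \<in> (*\<^sub>R) (\<Sum>i\<in>A. real (a $ i)) ` P" if "finite A" for A
    using that
  proof induction
    case empty
    then show ?case using zero_P by (simp add: image_constant_conv) blast
  next
    case (insert i A)
    have "real (a $ i) *\<^sub>R axis i 1 + (\<Sum>i\<in>A. real (a $ i) *\<^sub>R axis i 1)
        \<in> (*\<^sub>R) (real (a $ i) + (\<Sum>i\<in>A. real (a $ i))) ` P"
      using insert axis_P by (intro scaled_add) (auto intro: sum_nonneg)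
    with insert show ?case by simp
  qed
  moreover have "real_vec (int_exp a) = (\<Sum>i\<in>UNIV. real (a $ i) *\<^sub>R axis i 1)"
    by (simp add: vec_eq_iff real_vec_def int_exp_def axis_def if_distrib cong: if_cong)
  ultimately show ?thesis by simp
qed

lemma laurent_of_sections_exists: "\<exists>r\<ge>0. laurent_of G \<in> sections r"
proof -
  define r where "r = (\<Sum>a\<in>Poly_Mapping.keys G. \<Sum>i\<in>UNIV. real (a $ i))"
  have r0: "0 \<le> r" by (simp add: r_def sum_nonneg)
  have "real_vec (int_exp a) \<in> (*\<^sub>R) r ` P" if "a \<in> Poly_Mapping.keys G" for a
  proof -
    have "(\<Sum>i\<in>UNIV. real (a $ i)) \<le> r"
      unfolding r_def using that by (intro member_le_sum) (auto intro: sum_nonneg)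
    then show ?thesis
      using scaled_mono[of "\<Sum>i\<in>UNIV. real (a $ i)" r] real_vec_int_exp_scaled[of a]
      by (auto simp: sum_nonneg)
  qed
  then have "laurent_of G \<in> sections r"
    by (auto simp: sections_def supported_on_def keys_laurent_of)
  with r0 show ?thesis by blast
qed

text \<open>The degree \<open>r\<close> depends on the cofactors;
  \<open>saturated_in_large_degree\<close> removes this dependence.\<close>

lemma gen_ideal_J:
  assumes "\<Phi> \<in> gen_ideal (F ` {1..m})"
  obtains r where "1 \<le> r" "laurent_of \<Phi> \<in> J r"
proof -
  obtain G where G: "\<Phi> = (\<Sum>j = 1..m. F j * G j)"
    using gen_ideal_image_subset[OF assms] by auto
  have "\<forall>j. \<exists>r\<ge>0. laurent_of (G j) \<in> sections r"
    using laurent_of_sections_exists by blast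
  then obtain r where r: "\<And>j. 0 \<le> r j \<and> laurent_of (G j) \<in> sections (r j)" by metis
  define r' where "r' = 1 + (\<Sum>j = 1..m. r j)"
  define g where "g j = (if j \<in> {1..m} then laurent_of (G j) else 0)" for j
  have "g j \<in> sections (r' - 1)" for j
  proof (cases "j \<in> {1..m}")
    case True
    have "r j \<le> (\<Sum>j = 1..m. r j)" using r by (intro member_le_sum[OF True]) auto
    then show ?thesis
      using sections_mono[of "r j" "r' - 1"] r[of j] True by (auto simp: g_def r'_def)
  qed (auto simp: g_def sections_zero)
  then have "(\<Sum>j = 1..m. f j * g j) \<in> J r'" by (rule J_intro)
  moreover have "laurent_of \<Phi> = (\<Sum>j = 1..m. f j * g j)"
    by (simp add: G laurent_of_sum laurent_of_mult f_def g_def)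
  moreover have "1 \<le> r'" using r by (simp add: r'_def sum_nonneg)
  ultimately show thesis using that by simp
qed

text \<open>Cofactors found among Laurent polynomials are polynomials because multiples of
  \<open>P\<close> stay in the first orthant.\<close>

lemma sections_laurent_of:
  assumes "0 \<le> e" "x \<in> sections e"
  obtains G where "laurent_of G = x"
proof (rule laurent_of_surj)
  show "Poly_Mapping.keys x \<subseteq> range int_exp"
  proof
    fix a assume "a \<in> Poly_Mapping.keys x"
    then obtain p where p: "p \<in> P" "real_vec a = e *\<^sub>R p"
      using assms(2) unfolding sections_def supported_on_def by blast
    have "0 \<le> a $ i" for i
    proof -
      have "0 \<le> p $ i" using p(1) orthant by (auto simp: first_orthant_def)
      then have "0 \<le> real_vec a $ i" using p(2) assms(1) by simp
      then show ?thesis by (simp add: real_vec_def)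
    qed
    then have "a = int_exp (\<chi> i. nat (a $ i))" by (simp add: int_exp_def vec_eq_iff)
    then show "a \<in> range int_exp" by blast
  qed
qed (rule that)

lemma effective_membership:
  "\<exists>\<nu>\<ge>1. \<forall>e. \<forall>\<Phi>. \<Phi> \<in> gen_ideal (F ` {1..m}) \<longrightarrow> 0 \<le> e \<longrightarrow> supp \<Phi> \<subseteq> (*\<^sub>R) e ` P \<longrightarrow>
    (\<exists>G. (\<Sum>j = 1..m. F j * G j) = \<Phi> \<and>
      (\<forall>j\<in>{1..m}. supp (F j * G j) \<subseteq> (*\<^sub>R) (max \<nu> e) ` P))"
proof -
  obtain \<nu> where \<nu>: "1 \<le> \<nu>"
    "\<And>e x r. \<nu> \<le> e \<Longrightarrow> x \<in> sections e \<Longrightarrow> x \<in> J r \<Longrightarrow> 1 \<le> r \<Longrightarrow> x \<in> J e"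
    using saturated_in_large_degree by blast
  show ?thesis
  proof (intro exI[of _ \<nu>] conjI allI impI)
    fix e \<Phi>
    assume \<Phi>: "\<Phi> \<in> gen_ideal (F ` {1..m})" and e: "0 \<le> e" and s: "supp \<Phi> \<subseteq> (*\<^sub>R) e ` P"
    \<comment> \<open>For \<open>e\<close> below the threshold, \<open>\<Phi>\<close> is regarded as
      an element of degree \<open>\<nu>\<close>. This is the origin of the maximum.\<close>
    let ?e = "max \<nu> e"
    have "laurent_of \<Phi> \<in> sections e"
      using s by (auto simp: sections_def supported_on_def supp_eq_real_vec_keys)
    then have "laurent_of \<Phi> \<in> sections ?e" using sections_mono[of e ?e] e by auto
    moreover obtain r where "1 \<le> r" "laurent_of \<Phi> \<in> J r" using gen_ideal_J[OF \<Phi>] .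
    ultimately have "laurent_of \<Phi> \<in> J ?e" using \<nu>(2) by simp
    then obtain g where g: "laurent_of \<Phi> = (\<Sum>j = 1..m. f j * g j)" "\<And>j. g j \<in> sections (?e - 1)"
      using J_elim[of "laurent_of \<Phi>" ?e] by blast
    have e1: "0 \<le> ?e - 1" using \<nu>(1) by simp
    have "\<forall>j. \<exists>G. laurent_of G = g j" using sections_laurent_of[OF e1 g(2)] by metis
    then obtain G where G: "\<And>j. laurent_of (G j) = g j" by metis
    have "laurent_of (\<Sum>j = 1..m. F j * G j) = laurent_of \<Phi>"
      by (simp add: laurent_of_sum laurent_of_mult G g(1) f_def)
    then have "(\<Sum>j = 1..m. F j * G j) = \<Phi>" by (rule injD[OF inj_laurent_of])
    moreover have "supp (F j * G j) \<subseteq> (*\<^sub>R) ?e ` P" if "j \<in> {1..m}" for j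
    proof -
      \<comment> \<open>\<open>F j\<close> has degree \<open>1\<close> and its cofactor degree
        \<open>?e - 1\<close>, so each product separately, not only the sum, respects the
        bound.\<close>
      have "laurent_of (F j * G j) \<in> sections (1 + (?e - 1))"
        unfolding laurent_of_mult G using f_sections[OF that] g(2) e1
        by (intro sections_mult) (auto simp: f_def)
      then show ?thesis by (auto simp: sections_def supported_on_def supp_eq_real_vec_keys)
    qed
    ultimately show "\<exists>G. (\<Sum>j = 1..m. F j * G j) = \<Phi> \<and>
        (\<forall>j\<in>{1..m}. supp (F j * G j) \<subseteq> (*\<^sub>R) ?e ` P)" by blast
  qed (fact \<nu>(1))
qed

end

theorem theorem1p2:
  fixes F :: "nat \<Rightarrow> 'n::finite cpoly"
    and m :: nat
    and P :: "(real ^ 'n) set"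
  assumes "smooth_polytope P"
    and "P \<subseteq> first_orthant"
    and "0 \<in> P"
    and "\<forall>j\<in>{1..m}. supp (F j) \<subseteq> P"
    and "\<forall>i. axis i 1 \<in> P"
    and "no_common_zeros_at_infinity P m F"
  shows "\<exists>\<nu>::real. \<forall>e::real. 0 \<le> e \<longrightarrow> lattice_polytope ((*\<^sub>R) e ` P) \<longrightarrow>
           (\<forall>\<Phi>. \<Phi> \<in> gen_ideal (F ` {1..m}) \<longrightarrow> supp \<Phi> \<subseteq> (*\<^sub>R) e ` P \<longrightarrow>
              (\<exists>G :: nat \<Rightarrow> 'n cpoly.
                 (\<Sum>j = 1..m. F j * G j) = \<Phi> \<and>
                 (\<forall>j\<in>{1..m}. supp (F j * G j) \<subseteq> (*\<^sub>R) (max \<nu> e) ` P)))"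
proof -
  have "lattice_polytope P"
    using assms(1) unfolding smooth_polytope_def by (rule conjunct1)
  then obtain S where S: "finite S" "P = convex hull (real_vec ` S)"
    unfolding lattice_polytope_def by (elim exE conjE)
  interpret sparse_system P S m F
  proof
    show "supp (F j) \<subseteq> P" if "j \<in> {1..m}" for j using assms(4) that by (rule bspec)
    show "axis i 1 \<in> P" for i using assms(5) by (rule spec)
  qed (fact S assms)+
  obtain \<nu> where "\<forall>e \<Phi>. \<Phi> \<in> gen_ideal (F ` {1..m}) \<longrightarrow> 0 \<le> e \<longrightarrow> supp \<Phi> \<subseteq> (*\<^sub>R) e ` P \<longrightarrow>
    (\<exists>G. (\<Sum>j = 1..m. F j * G j) = \<Phi> \<and>
      (\<forall>j\<in>{1..m}. supp (F j * G j) \<subseteq> (*\<^sub>R) (max \<nu> e) ` P))"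
    using effective_membership by (elim exE conjE)
  then show ?thesis by (intro exI[of _ \<nu>]) simp
qed

end
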